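(* Let $n(2)=3$, $n(3)=4$, $n(4)=6$, $n(5)=12$. Let $N\in\{2,3,4,5\}$ and let $f_N:\mathbb{H}\to\mathbb{CP}^1\setminus\{a_1=0,a_2,\ldots,a_{n(N)}\}$ be a universal covering with deck transformation group $\operatorname{Aut}(f_N)=\Gamma(N)$, the principal congruence subgroup of level $N$, and such that $f_N$ vanishes at infinity. Then $f_N$ can be given by the expansion $$f_N=f_N(\tau)=A\left(q_N+\frac{B}{A}q_N^2+\sum_{m=3}^{\infty}\mathbf{c}_m\!\left(\tfrac{B}{A}\right)q_N^m\right)$$ in $q_N=\exp\{\frac{2\pi}{N}i\tau\}$, $\tau\in\mathbb{H}$, where the constants $A,B\in\mathbb{C}$ are uniquely determined by the set of values of the punctured points $\{a_1=0,a_2,\ldots,a_{n(N)}\}$, and the coefficient $\mathbf{c}_m(\frac{B}{A})$ is a polynomial in $\frac{B}{A}$ with constant coefficients for every $m\ge3$.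
   Context: $\mathbb{H}$ is the upper half plane. $\operatorname{Aut}(f)$ denotes the deck transformation group of a universal covering $f:\mathbb{H}\to\mathbb{CP}^1\setminus\{a_1,\ldots,a_n\}$, i.e. the group of $\gamma\in\operatorname{Aut}(\mathbb{H})$ with $f\circ\gamma=f$. The principal congruence subgroup of level $N$ is $$\Gamma(N)=\left\{\begin{pmatrix}a&b\\c&d\end{pmatrix}\in\mathrm{SL}_2(\mathbb{Z})\;:\;\begin{pmatrix}a&b\\c&d\end{pmatrix}\equiv\pm\begin{pmatrix}1&0\\0&1\end{pmatrix}\pmod N\right\}\Big/\pm I,$$ acting on $\mathbb{H}$ by Möbius transformations. The number $n(N)$ is the number of cusps of $\Gamma(N)$. "$f_N$ vanishes at infinity" means $f_N(\infty)=0$, i.e. $f_N(\tau)\to0$ as $\operatorname{Im}\tau\to\infty$.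
   Formalization: The set of punctures fixes A, B only up to (ζA, ζ²B), ζ^N=1 (λ(τ), λ(τ+1) share punctures, A=±16); A, B are unique if values at all cusps are prescribed. The expansion holds on each half plane Im τ>y (y≥0) without poles of f_N, which is all of ℍ if ∞ is a puncture. *)

theory Defs
  imports "HOL-Complex_Analysis.Complex_Analysis" "HOL-Number_Theory.Cong"
begin

section \<open>The Riemann sphere\<close>

text \<open>The complex projective line, as the one-point compactification of the complex plane.\<close>

datatype cp1 = Fin complex | Infty

instantiation cp1 :: topological_space
begin

definition open_cp1 :: "cp1 set \<Rightarrow> bool" where
  "open_cp1 U \<longleftrightarrow> open {z. Fin z \<in> U} \<and> (Infty \<in> U \<longrightarrow> compact {z. Fin z \<notin> U})"

instance
proof
  show "open (UNIV :: cp1 set)"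
    by (simp add: open_cp1_def)
next
  fix S T :: "cp1 set"
  assume ST: "open S" "open T"
  have "{z. Fin z \<in> S \<inter> T} = {z. Fin z \<in> S} \<inter> {z. Fin z \<in> T}"
    and "{z. Fin z \<notin> S \<inter> T} = {z. Fin z \<notin> S} \<union> {z. Fin z \<notin> T}"
    by auto
  with ST show "open (S \<inter> T)"
    unfolding open_cp1_def by (metis Int_iff compact_Un open_Int)
next
  fix K :: "cp1 set set"
  assume K: "\<forall>S\<in>K. open S"
  have eq: "{z. Fin z \<in> \<Union>K} = (\<Union>S\<in>K. {z. Fin z \<in> S})"
    by auto
  have op: "open {z. Fin z \<in> \<Union>K}"
    unfolding eq using K by (auto simp: open_cp1_def)
  moreover have "compact {z. Fin z \<notin> \<Union>K}" if "Infty \<in> \<Union>K"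
  proof -
    from that obtain S where S: "S \<in> K" "Infty \<in> S" by blast
    with K have "compact {z. Fin z \<notin> S}"
      by (simp add: open_cp1_def)
    moreover have "closed {z. Fin z \<notin> \<Union>K}"
      using op unfolding Collect_neg_eq closed_def by simp
    moreover have "{z. Fin z \<notin> \<Union>K} = {z. Fin z \<notin> S} \<inter> {z. Fin z \<notin> \<Union>K}"
      using S by blast
    ultimately show ?thesis
      by (metis compact_Int_closed)
  qed
  ultimately show "open (\<Union>K)"
    by (simp add: open_cp1_def)
qed

end

text \<open>The two standard charts; the values at the point outside the domain of each are irrelevant.\<close>

fun chart_0 :: "cp1 \<Rightarrow> complex" where
  "chart_0 (Fin z) = z"
| "chart_0 Infty = 0"

fun chart_infty :: "cp1 \<Rightarrow> complex" where
  "chart_infty (Fin z) = 1 / z"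
| "chart_infty Infty = 0"

definition holomorphic_map_cp1 :: "complex set \<Rightarrow> (complex \<Rightarrow> cp1) \<Rightarrow> bool" where
  "holomorphic_map_cp1 S f \<longleftrightarrow>
     (\<forall>z\<in>S. \<exists>U. open U \<and> z \<in> U \<and> U \<subseteq> S \<and>
        ((Infty \<notin> f ` U \<and> (chart_0 \<circ> f) holomorphic_on U) \<or>
         (Fin 0 \<notin> f ` U \<and> (chart_infty \<circ> f) holomorphic_on U)))"

text \<open>In the library, simple connectedness includes path-connectedness.\<close>

definition universal_covering :: "complex set \<Rightarrow> (complex \<Rightarrow> cp1) \<Rightarrow> cp1 set \<Rightarrow> bool" where
  "universal_covering S f X \<longleftrightarrow>
     simply_connected S \<and> holomorphic_map_cp1 S f \<and> covering_space S f X"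

section \<open>Automorphisms of the upper half plane\<close>

definition upper_half_plane :: "complex set" ("\<H>") where
  "\<H> = {\<tau>. Im \<tau> > 0}"

text \<open>Automorphisms are extensional functions, so that equality of automorphisms is
  equality on the upper half plane.\<close>

definition Aut_upper_half_plane :: "(complex \<Rightarrow> complex) set" where
  "Aut_upper_half_plane =
     {\<gamma> \<in> extensional \<H>. \<gamma> holomorphic_on \<H> \<and> bij_betw \<gamma> \<H> \<H> \<and> inv_into \<H> \<gamma> holomorphic_on \<H>}"

definition deck_group :: "(complex \<Rightarrow> cp1) \<Rightarrow> (complex \<Rightarrow> complex) set" where
  "deck_group f = {\<gamma> \<in> Aut_upper_half_plane. \<forall>\<tau>\<in>\<H>. f (\<gamma> \<tau>) = f \<tau>}"

definition moebius :: "int^2^2 \<Rightarrow> complex \<Rightarrow> complex" where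
  "moebius M \<tau> = (of_int (M$1$1) * \<tau> + of_int (M$1$2)) / (of_int (M$2$1) * \<tau> + of_int (M$2$2))"

definition SL2Z :: "(int^2^2) set" where
  "SL2Z = {M. det M = 1}"

text \<open>The principal congruence subgroup, as a group of automorphisms of the upper half plane;
  passing from matrices to Moebius maps is exactly the passage to the quotient by the
  scalar matrices 1 and -1.\<close>

definition principal_congruence_matrices :: "nat \<Rightarrow> (int^2^2) set" where
  "principal_congruence_matrices N =
     {M \<in> SL2Z. (\<forall>i j. [M$i$j = mat 1 $i$j] (mod int N)) \<or>
                (\<forall>i j. [M$i$j = - (mat 1 $i$j)] (mod int N))}"

definition Gamma_group :: "nat \<Rightarrow> (complex \<Rightarrow> complex) set" where
  "Gamma_group N = (\<lambda>M. restrict (moebius M) \<H>) ` principal_congruence_matrices N"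

section \<open>Behaviour at the cusps\<close>

definition Im_at_top :: "complex filter" where
  "Im_at_top = filtercomap Im at_top"

text \<open>The cusps are the points of the rational projective line; each of them is the image
  of infinity under some integral matrix M of determinant 1. The value at that cusp does not
  depend on the choice of M.\<close>

definition cusp_value :: "(complex \<Rightarrow> cp1) \<Rightarrow> int^2^2 \<Rightarrow> cp1 \<Rightarrow> bool" where
  "cusp_value f M p \<longleftrightarrow> ((\<lambda>\<tau>. f (moebius M \<tau>)) \<longlongrightarrow> p) Im_at_top"

definition vanishes_at_infinity :: "(complex \<Rightarrow> cp1) \<Rightarrow> bool" where
  "vanishes_at_infinity f \<longleftrightarrow> (f \<longlongrightarrow> Fin 0) Im_at_top"

section \<open>Normalised coverings and their expansions\<close>

definition level_covering :: "nat \<Rightarrow> nat \<Rightarrow> cp1 set \<Rightarrow> (complex \<Rightarrow> cp1) \<Rightarrow> bool" where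
  "level_covering N n P f \<longleftrightarrow>
     finite P \<and> card P = n \<and> Fin 0 \<in> P \<and>
     universal_covering \<H> f (- P) \<and> deck_group f = Gamma_group N \<and> vanishes_at_infinity f"

definition q_param :: "nat \<Rightarrow> complex \<Rightarrow> complex" where
  "q_param N \<tau> = exp (2 * pi / N * \<i> * \<tau>)"

text \<open>If infinity is not a puncture then f has poles in the upper half plane, and the series
  has radius of convergence less than 1. The expansion is therefore required on each half
  plane on which f is finite, and f has to be finite on one of these. If infinity is a
  puncture, this includes the whole upper half plane (y = 0).\<close>

definition has_expansion ::
  "nat \<Rightarrow> (nat \<Rightarrow> complex poly) \<Rightarrow> (complex \<Rightarrow> cp1) \<Rightarrow> complex \<Rightarrow> complex \<Rightarrow> bool" where
  "has_expansion N c f A B \<longleftrightarrow>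
     A \<noteq> 0 \<and>
     (\<forall>\<^sub>F \<tau> in Im_at_top. f \<tau> \<noteq> Infty) \<and>
     (\<forall>y\<ge>0. (\<forall>\<tau>. Im \<tau> > y \<longrightarrow> f \<tau> \<noteq> Infty) \<longrightarrow>
        (\<forall>\<tau>. Im \<tau> > y \<longrightarrow>
           (\<exists>s. (\<lambda>k. poly (c (k + 3)) (B / A) * q_param N \<tau> ^ (k + 3)) sums s \<and>
                f \<tau> = Fin (A * (q_param N \<tau> + B / A * q_param N \<tau> ^ 2 + s)))))"

end

theory Submission
  imports Defs
begin

text \<open>
  As 0 is a puncture, p = 1 / f is an honest holomorphic covering of a plane punctured at
  finitely many points, with a pole at the cusp infinity, and its fibres are the orbits of
  the group. For two such coverings p and p', the map from p to p' extends over the punctures and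
  grows at most linearly, so p' = \<alpha> p + \<beta>. Hence all admissible f arise from a single one, h,
  as h / (\<alpha> + \<beta> h), and comparing q-expansions gives the polynomials; existence of h need not be
  shown, since otherwise the statement is vacuous.

  If f and g omit the same punctures, g lifts through f. The lift can be chosen to fix the cusp
  infinity, so it descends to a self-map of the unit disc fixing 0. The same holds with f and g
  exchanged, and the derivatives at 0 of the two self-maps are inverse to each other. By the
  Schwarz lemma the self-map is a rotation, that is, g(\<tau>) = f(\<tau> + k) with k real.
  Conjugating an element of the group by this translation shows that k is an integer.
  If f and g have the same value at the cusp 0, then the horoballs at 0 and at k contain
  equivalent points, which forces N to divide k.
\<close>

section \<open>The chart at infinity\<close>

text \<open>One estimate provides the coordinates at infinity: if a point with Im > 1 and a point
  with Im >= 1 are equivalent under the group, they differ by a multiple of N. Hence q is an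
  injective coordinate of the quotient near the cusp, 1 / p has a simple zero in q (so A \<noteq>
  0), and all sufficiently large values are taken by p above any given height. This last fact lets
  the heights of one covering control the size of another: it bounds the induced map near the finite
  punctures without looking at the other cusps, and it starts the lift in the right horoball. Only
  the cusp 0 is examined separately. The value there is not given in advance and may be finite or
  infinite; that it exists is drawn from the great Picard theorem, whose two omitted values come
  from having at least three punctures. A second cusp is unavoidable: a shift by an integer
  preserves the group, the omitted set and the value at infinity, so only a further labelled cusp
  can tell the shifts modulo N apart.\<close>

definition inv_chart :: "complex \<Rightarrow> cp1" where
  "inv_chart w = (if w = 0 then Infty else Fin (1 / w))"

lemma chart_infty_inv_chart [simp]: "chart_infty (inv_chart w) = w"
  by (simp add: inv_chart_def)

text \<open>\<open>chart_infty\<close> sends both \<open>Infty\<close> and, because 1 / 0 = 0, also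
  \<open>Fin 0\<close> to 0; hence the hypothesis, and the restriction to \<open>- {Fin 0}\<close>
  below.\<close>

lemma inv_chart_chart_infty: "x \<noteq> Fin 0 \<Longrightarrow> inv_chart (chart_infty x) = x"
  by (cases x) (auto simp: inv_chart_def)

lemma inv_chart_neq_0 [simp]: "inv_chart w \<noteq> Fin 0"
  by (simp add: inv_chart_def)

lemma open_cp1_iff:
  "open U \<longleftrightarrow> open {z. Fin z \<in> U} \<and> (Infty \<in> U \<longrightarrow> compact {z. Fin z \<notin> U})"
  by (rule open_cp1_def)

lemma open_inverse_preimage:
  assumes "open V"
  shows "open {w :: complex. w \<noteq> 0 \<and> 1 / w \<in> V}"
proof -
  have "open ((- {0}) \<inter> (\<lambda>w::complex. 1 / w) -` V)"
    by (rule continuous_open_preimage) (use assms in \<open>auto intro!: continuous_on_divide continuous_on_const continuous_on_id\<close>)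
  also have "(- {0}) \<inter> (\<lambda>w::complex. 1 / w) -` V = {w. w \<noteq> 0 \<and> 1 / w \<in> V}" by auto
  finally show ?thesis .
qed

text \<open>Only neighbourhoods of \<open>Infty\<close> need an argument: the finite points outside
  one are bounded by some B, so its preimage contains the disc of radius 1 / B about 0.\<close>

lemma continuous_on_inv_chart: "continuous_on UNIV inv_chart"
proof (subst continuous_on_open_vimage, simp, intro allI impI)
  fix U :: "cp1 set" assume U: "open U"
  let ?V = "{z. Fin z \<in> U}"
  have V: "open {w :: complex. w \<noteq> 0 \<and> 1 / w \<in> ?V}"
    using U open_cp1_iff by (intro open_inverse_preimage) blast
  show "open (inv_chart -` U \<inter> UNIV)"
  proof (cases "Infty \<in> U")
    case False
    then have "inv_chart -` U \<inter> UNIV = {w :: complex. w \<noteq> 0 \<and> 1 / w \<in> ?V}"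
      by (auto simp: inv_chart_def split: if_splits)
    with V show ?thesis by simp
  next
    case True
    then have "bounded {z. Fin z \<notin> U}"
      using U open_cp1_iff compact_imp_bounded by blast
    then obtain B where B: "B > 0" "\<And>z. Fin z \<notin> U \<Longrightarrow> norm z < B"
      by (auto simp: bounded_pos_less)
    have "Fin (1 / w) \<in> U" if "w \<noteq> 0" "norm w < 1 / B" for w
    proof (rule ccontr)
      assume "Fin (1 / w) \<notin> U"
      from B(2)[OF this] that B(1) show False by (simp add: norm_divide field_simps)
    qed
    with True have "inv_chart -` U \<inter> UNIV = {w :: complex. w \<noteq> 0 \<and> 1 / w \<in> ?V} \<union> ball 0 (1 / B)"
      using B(1) by (auto simp: inv_chart_def split: if_splits)
    with V show ?thesis by auto
  qed
qed

lemma open_compl_Fin_0: "open (- {Fin 0})"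
proof -
  have "{z. Fin z \<in> - {Fin 0}} = - {0}" by auto
  moreover have "{z. Fin z \<notin> - {Fin 0}} = {0}" by auto
  ultimately show ?thesis by (simp add: open_cp1_iff open_Compl)
qed

lemma continuous_on_chart_infty: "continuous_on (- {Fin 0}) chart_infty"
proof (subst continuous_on_open_vimage, rule open_compl_Fin_0, intro allI impI)
  fix W :: "complex set" assume W: "open W"
  have *: "open {z :: complex. z \<noteq> 0 \<and> 1 / z \<in> W}"
    by (rule open_inverse_preimage[OF W])
  have eq: "{z. Fin z \<in> chart_infty -` W \<inter> - {Fin 0}} = {z :: complex. z \<noteq> 0 \<and> 1 / z \<in> W}"
    by auto
  \<comment> \<open>\<open>0 \<in> W\<close> is the case in which the preimage contains
    \<open>Infty\<close>. Then W contains a disc of radius e about 0, so the points left out have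
    norm at most 1 / e.\<close>
  have "compact {z. Fin z \<notin> chart_infty -` W \<inter> - {Fin 0}}" if "0 \<in> W"
  proof -
    from W that obtain e where e: "e > 0" "ball 0 e \<subseteq> W" by (auto simp: open_contains_ball)
    have "norm z \<le> 1 / e" if "\<not> (z \<noteq> 0 \<and> 1 / z \<in> W)" for z
    proof (rule ccontr)
      assume z: "\<not> norm z \<le> 1 / e"
      with e have "norm z > 0" "norm (1 / z) < e" by (auto simp: norm_divide divide_simps mult.commute split: if_splits)
      with e z that show False by auto
    qed
    then have "bounded {z. Fin z \<notin> chart_infty -` W \<inter> - {Fin 0}}"
      unfolding bounded_iff by (intro exI[of _ "1 / e"]) auto
    moreover have "closed {z. Fin z \<notin> chart_infty -` W \<inter> - {Fin 0}}"
      using * unfolding eq[symmetric] Collect_neg_eq closed_def by simp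
    ultimately show ?thesis by (simp add: compact_eq_bounded_closed)
  qed
  then show "open (chart_infty -` W \<inter> - {Fin 0})"
    unfolding open_cp1_iff eq using * by simp
qed

lemma homeomorphism_chart_infty: "homeomorphism (- {Fin 0}) UNIV chart_infty inv_chart"
proof (rule homeomorphismI[OF continuous_on_chart_infty continuous_on_inv_chart])
  show "inv_chart ` UNIV \<subseteq> - {Fin 0}" by (auto simp: inv_chart_def split: if_splits)
  show "inv_chart (chart_infty x) = x" if "x \<in> - {Fin 0}" for x
    using that by (intro inv_chart_chart_infty) blast
qed simp_all

lemma tendsto_inv_chart: "(u \<longlongrightarrow> l) F \<Longrightarrow> ((\<lambda>x. inv_chart (u x)) \<longlongrightarrow> inv_chart l) F"
  by (rule continuous_on_tendsto_compose[OF continuous_on_inv_chart]) simp_all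

lemma tendsto_chart_infty:
  assumes "(u \<longlongrightarrow> x) F" "x \<noteq> Fin 0"
  shows "((\<lambda>t. chart_infty (u t)) \<longlongrightarrow> chart_infty x) F"
proof (rule continuous_on_tendsto_compose[OF continuous_on_chart_infty assms(1)])
  show "\<forall>\<^sub>F t in F. u t \<in> - {Fin 0}"
    by (rule topological_tendstoD[OF assms(1) open_compl_Fin_0]) (use assms in auto)
qed (use assms in auto)

text \<open>The second premise excludes \<open>Fin 0\<close> itself, where
  \<open>chart_infty\<close> takes the value 0 instead of a large one.\<close>

lemma filterlim_chart_infty_at_infinity:
  assumes "(u \<longlongrightarrow> Fin 0) F" "\<forall>\<^sub>F t in F. u t \<noteq> Fin 0"
  shows "filterlim (\<lambda>t. chart_infty (u t)) at_infinity F"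
  unfolding filterlim_at_infinity[OF order.refl]
proof (intro allI impI)
  fix r :: real assume r: "r > 0"
  have "open (Fin ` ball 0 (1 / r))"
    unfolding open_cp1_iff using open_ball[of "0::complex" "1 / r"] by (simp add: image_iff ball_def)
  then have "\<forall>\<^sub>F t in F. u t \<in> Fin ` ball 0 (1 / r)"
    by (rule topological_tendstoD[OF assms(1)]) (use r in auto)
  with assms(2) show "\<forall>\<^sub>F t in F. r \<le> norm (chart_infty (u t))"
    by eventually_elim (use r in \<open>auto simp: norm_divide field_simps\<close>)
qed

lemma tendsto_inv_chart_at_infinity:
  assumes "filterlim u at_infinity F"
  shows "((\<lambda>t. inv_chart (u t)) \<longlongrightarrow> Fin 0) F"
proof (rule topological_tendstoI)
  fix U assume U: "open U" "Fin 0 \<in> U"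
  then have "open {z. Fin z \<in> U}" by (simp add: open_cp1_iff)
  with U(2) obtain e where e: "e > 0" "ball 0 e \<subseteq> {z. Fin z \<in> U}"
    by (force simp: open_contains_ball)
  have "\<forall>\<^sub>F t in F. 2 / e \<le> norm (u t)"
    using assms e(1) unfolding filterlim_at_infinity[OF order.refl] by simp
  then show "\<forall>\<^sub>F t in F. inv_chart (u t) \<in> U"
  proof eventually_elim
    case (elim t)
    \<comment> \<open>The bound 2 / e was asked for to make this inequality strict.\<close>
    have "norm (u t) > 1 / e" by (rule less_le_trans[OF _ elim]) (use e in \<open>auto simp: field_simps\<close>)
    then have "u t \<noteq> 0" "norm (1 / u t) < e"
      using e by (auto simp: norm_divide divide_simps mult.commute split: if_splits)
    with e show ?case by (auto simp: inv_chart_def)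
  qed
qed

text \<open>The sheets over an evenly covered set \<open>T\<close> also serve as the sheets over its
  image under \<open>f\<close>.\<close>

lemma covering_space_compose_homeomorphism:
  fixes c :: "'a::topological_space set" and p :: "'a \<Rightarrow> 'b::topological_space"
    and f :: "'b \<Rightarrow> 'c::topological_space"
  assumes cov: "covering_space c p S" and hom: "homeomorphism S S' f g"
  shows "covering_space c (f \<circ> p) S'"
  unfolding covering_space_def
proof (intro conjI ballI)
  have pS: "p ` c = S" and contp: "continuous_on c p" using cov by (auto simp: covering_space_def)
  have "continuous_on (p ` c) f" using hom pS by (simp add: homeomorphism_def)
  with contp show "continuous_on c (f \<circ> p)" by (rule continuous_on_compose)
  show "(f \<circ> p) ` c = S'"
    using pS hom by (auto simp: homeomorphism_def image_comp[symmetric])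
  fix y assume y: "y \<in> S'"
  then have "g y \<in> S" using hom by (auto simp: homeomorphism_def)
  then obtain T v where T: "g y \<in> T" "openin (top_of_set S) T" "\<Union>v = c \<inter> p -` T"
    "\<forall>u \<in> v. openin (top_of_set c) u" "pairwise disjnt v" "\<forall>u \<in> v. \<exists>q. homeomorphism u T p q"
    using cov unfolding covering_space_def by blast
  have TS: "T \<subseteq> S" using T(2) openin_imp_subset by blast
  have homT: "homeomorphism T (f ` T) f g"
    by (rule homeomorphism_of_subsets[OF hom TS subset_refl refl])
  show "\<exists>T. y \<in> T \<and> openin (top_of_set S') T \<and>
          (\<exists>v. \<Union> v = c \<inter> (f \<circ> p) -` T \<and> (\<forall>u\<in>v. openin (top_of_set c) u) \<and> pairwise disjnt v \<and>
               (\<forall>u\<in>v. \<exists>q. homeomorphism u T (f \<circ> p) q))"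
  proof (intro exI conjI)
    show "y \<in> f ` T" using T(1) y hom by (auto simp: homeomorphism_def image_iff intro!: bexI[of _ "g y"])
    show "openin (top_of_set S') (f ` T)"
      by (rule homeomorphism_imp_open_map[OF hom T(2)])
    show "\<Union>v = c \<inter> (f \<circ> p) -` (f ` T)"
    proof -
      have "f (p x) \<in> f ` T \<longleftrightarrow> p x \<in> T" if "x \<in> c" for x
      proof -
        have "g (f (p x)) = p x" using that pS hom by (auto simp: homeomorphism_def)
        moreover have "\<And>t. t \<in> T \<Longrightarrow> g (f t) = t" using TS hom by (auto simp: homeomorphism_def)
        ultimately show ?thesis by (force simp: image_iff)
      qed
      then have "c \<inter> (f \<circ> p) -` (f ` T) = c \<inter> p -` T" by (intro set_eqI) (simp cong: conj_cong)
      with T(3) show ?thesis by simp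
    qed
    show "\<forall>u\<in>v. \<exists>q. homeomorphism u (f ` T) (f \<circ> p) q"
    proof
      fix u assume "u \<in> v"
      with T(6) obtain q where "homeomorphism u T p q" by blast
      show "\<exists>q. homeomorphism u (f ` T) (f \<circ> p) q"
        by (rule exI[of _ "q \<circ> g"]) (rule homeomorphism_compose[OF \<open>homeomorphism u T p q\<close> homT])
    qed
  qed (use T(4,5) in simp_all)
qed

section \<open>Moebius transformations and the parameter q\<close>

lemma open_upper_half_plane: "open \<H>"
  unfolding upper_half_plane_def by (rule open_halfspace_Im_gt)

lemma convex_upper_half_plane: "convex \<H>"
  unfolding upper_half_plane_def by (rule convex_halfspace_Im_gt)

lemma in_upper_half_plane_iff: "\<tau> \<in> \<H> \<longleftrightarrow> Im \<tau> > 0"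
  by (simp add: upper_half_plane_def)

lemma eventually_Im_at_top: "eventually P Im_at_top \<longleftrightarrow> (\<exists>y. \<forall>\<tau>. Im \<tau> > y \<longrightarrow> P \<tau>)"
proof -
  have "eventually P Im_at_top \<longleftrightarrow> (\<exists>Q. (\<exists>y. \<forall>x. x > y \<longrightarrow> Q x) \<and> (\<forall>\<tau>. Q (Im \<tau>) \<longrightarrow> P \<tau>))"
    by (simp add: Im_at_top_def eventually_filtercomap eventually_at_top_dense)
  also have "\<dots> \<longleftrightarrow> (\<exists>y. \<forall>\<tau>. Im \<tau> > y \<longrightarrow> P \<tau>)"
    by (metis (mono_tags, lifting))
  finally show ?thesis .
qed

lemma eventually_Im_at_top_gt: "\<forall>\<^sub>F \<tau> in Im_at_top. Im \<tau> > y"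
  unfolding eventually_Im_at_top by blast

section \<open>Integral Moebius transformations and horoballs\<close>

definition mat2 :: "int \<Rightarrow> int \<Rightarrow> int \<Rightarrow> int \<Rightarrow> int^2^2" where
  "mat2 a b c d = vector [vector [a, b], vector [c, d]]"

lemma mat2_nth [simp]:
  "mat2 a b c d $ 1 $ 1 = a" "mat2 a b c d $ 1 $ 2 = b"
  "mat2 a b c d $ 2 $ 1 = c" "mat2 a b c d $ 2 $ 2 = d"
  by (simp_all add: mat2_def)

lemma mat2_in_SL2Z_iff: "mat2 a b c d \<in> SL2Z \<longleftrightarrow> a * d - b * c = 1"
  by (simp add: SL2Z_def det_2)

lemma moebius_mat2:
  "moebius (mat2 a b c d) \<tau> = (of_int a * \<tau> + of_int b) / (of_int c * \<tau> + of_int d)"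
  by (simp add: moebius_def)

lemma mat2_in_principal:
  assumes "a * d - b * c = 1" "[a = 1] (mod int N)" "[b = 0] (mod int N)" "[c = 0] (mod int N)" "[d = 1] (mod int N)"
  shows "mat2 a b c d \<in> principal_congruence_matrices N"
  using assms unfolding principal_congruence_matrices_def
  by (auto simp: mat2_in_SL2Z_iff forall_2 mat_def)

text \<open>The two signs in the definition matter on the diagonal only; modulo N the other entries
  vanish in both cases.\<close>

lemma principal_congruence_cases:
  assumes "M \<in> principal_congruence_matrices N"
  obtains a b c d :: int where "\<And>\<tau>. moebius M \<tau> = (of_int a * \<tau> + of_int b) / (of_int c * \<tau> + of_int d)"
    "a * d - b * c = 1" "int N dvd b" "int N dvd c"
    "[a = 1] (mod int N) \<and> [d = 1] (mod int N) \<or> [a = -1] (mod int N) \<and> [d = -1] (mod int N)"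
proof (rule that[of "M$1$1" "M$1$2" "M$2$1" "M$2$2"])
  show "M$1$1 * M$2$2 - M$1$2 * M$2$1 = 1"
    using assms by (simp add: principal_congruence_matrices_def SL2Z_def det_2)
qed (use assms in \<open>auto simp: principal_congruence_matrices_def forall_2 mat_def moebius_def cong_0_iff\<close>)

lemma moebius_denominator_nonzero:
  assumes "(a :: int) * d - b * c = 1" "Im \<tau> > 0"
  shows "of_int c * \<tau> + of_int d \<noteq> (0 :: complex)"
proof
  assume *: "of_int c * \<tau> + of_int d = (0 :: complex)"
  then have "Im (of_int c * \<tau> + of_int d) = 0" by (simp only: zero_complex.simps)
  then have "c = 0" using assms(2) by simp
  with * assms(1) show False by simp
qed

lemma Im_moebius:
  assumes "(a :: int) * d - b * c = 1" "Im \<tau> > 0"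
  shows "Im ((of_int a * \<tau> + of_int b) / (of_int c * \<tau> + of_int d)) =
         Im \<tau> / (norm (of_int c * \<tau> + of_int d))\<^sup>2"
proof -
  let ?w = "of_int c * \<tau> + of_int d"
  have "of_int a * of_int d - of_int b * of_int c = (1 :: real)"
    using assms(1) by (metis of_int_1 of_int_diff of_int_mult)
  then have *: "of_int a * of_int d * Im \<tau> - of_int b * of_int c * Im \<tau> = Im \<tau>"
    by (metis left_diff_distrib mult_1)
  have "Im ((of_int a * \<tau> + of_int b) / ?w) = Im ((of_int a * \<tau> + of_int b) * cnj ?w / (norm ?w)\<^sup>2)"
    by (metis complex_div_cnj)
  also have "\<dots> = Im ((of_int a * \<tau> + of_int b) * cnj ?w) / (norm ?w)\<^sup>2"
    by (metis Im_divide_of_real of_real_power)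
  also have "Im ((of_int a * \<tau> + of_int b) * cnj ?w) = Im \<tau>"
    using * by (simp add: algebra_simps)
  finally show ?thesis .
qed

text \<open>Since |c \<tau> + d| >= |c| Im \<tau>, a nonzero c would put the image at height at most
  1 / Im \<tau> < 1. One bound is strict and the other is not, so that the horocycle Im = 1 is
  covered too.\<close>

lemma moebius_horoball:
  assumes "(a :: int) * d - b * c = 1" "Im \<tau> > 1"
    and "Im ((of_int a * \<tau> + of_int b) / (of_int c * \<tau> + of_int d)) \<ge> 1"
  shows "c = 0"
proof (rule ccontr)
  assume "c \<noteq> 0"
  have "of_int c * \<tau> + of_int d \<noteq> 0" by (rule moebius_denominator_nonzero[OF assms(1)]) (use assms in simp)
  with assms have "(norm (of_int c * \<tau> + of_int d))\<^sup>2 \<le> Im \<tau>"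
    by (subst (asm) Im_moebius) (auto simp: field_simps)
  moreover have "(Im (of_int c * \<tau> + of_int d))\<^sup>2 \<le> (norm (of_int c * \<tau> + of_int d))\<^sup>2"
    using abs_Im_le_cmod[of "of_int c * \<tau> + of_int d"] by (metis abs_le_square_iff abs_norm_cancel)
  ultimately have "(of_int c)\<^sup>2 * (Im \<tau>)\<^sup>2 \<le> Im \<tau>" by (simp add: power_mult_distrib)
  moreover have "1 \<le> c\<^sup>2" using \<open>c \<noteq> 0\<close> zero_less_power2[of c] by linarith
  then have "1 \<le> (real_of_int c)\<^sup>2" by (metis of_int_1_le_iff of_int_power)
  then have "1 * (Im \<tau>)\<^sup>2 \<le> (of_int c)\<^sup>2 * (Im \<tau>)\<^sup>2" by (intro mult_right_mono) auto
  ultimately have "Im \<tau> * Im \<tau> \<le> Im \<tau> * 1" by (simp add: power2_eq_square)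
  with assms(2) show False by (subst (asm) mult_le_cancel_left) auto
qed

section \<open>The cusp parameter q = exp(2 pi i \<tau> / N)\<close>

lemma q_param_nonzero [simp]: "q_param N \<tau> \<noteq> 0"
  by (simp add: q_param_def)

lemma q_param_add: "q_param N (\<tau> + \<sigma>) = q_param N \<tau> * q_param N \<sigma>"
  by (simp add: q_param_def ring_distribs exp_add)

lemma norm_q_param: "norm (q_param N \<tau>) = exp (- (2 * pi / N * Im \<tau>))"
proof -
  have "2 * pi / N * \<i> * \<tau> = complex_of_real (2 * pi / N) * (\<i> * \<tau>)" by simp
  then have "Re (2 * pi / N * \<i> * \<tau>) = - (2 * pi / N * Im \<tau>)" by (simp only: Re_complex_of_real) simp
  then show ?thesis by (simp only: q_param_def norm_exp_eq_Re)
qed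

lemma norm_q_param_less_iff:
  assumes "N > 0"
  shows "norm (q_param N \<tau>) < exp (- (2 * pi / N * y)) \<longleftrightarrow> Im \<tau> > y"
  using assms by (simp add: norm_q_param divide_simps)

lemma q_param_eq_iff:
  assumes "N > 0"
  shows "q_param N \<tau> = q_param N \<tau>' \<longleftrightarrow> (\<exists>k :: int. \<tau>' = \<tau> + of_nat N * of_int k)"
proof -
  have "q_param N \<tau> = q_param N \<tau>' \<longleftrightarrow> q_param N \<tau>' = q_param N \<tau>" by auto
  also have "\<dots> \<longleftrightarrow> (\<exists>k :: int. 2 * pi / N * \<i> * \<tau>' = 2 * pi / N * \<i> * \<tau> + (of_int (2 * k) * pi) * \<i>)"
    unfolding q_param_def by (rule exp_eq)
  also have "\<dots> \<longleftrightarrow> (\<exists>k :: int. \<tau>' = \<tau> + of_nat N * of_int k)"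
  proof (intro ex_cong1)
    fix k :: int
    have "2 * pi / N * \<i> * \<tau>' = 2 * pi / N * \<i> * \<tau> + (of_int (2 * k) * pi) * \<i> \<longleftrightarrow>
          2 * pi / N * \<i> * \<tau>' = 2 * pi / N * \<i> * (\<tau> + of_nat N * of_int k)"
      using assms by (simp add: field_simps)
    also have "\<dots> \<longleftrightarrow> \<tau>' = \<tau> + of_nat N * of_int k"
      using assms by simp
    finally show "2 * pi / N * \<i> * \<tau>' = 2 * pi / N * \<i> * \<tau> + (of_int (2 * k) * pi) * \<i> \<longleftrightarrow>
      \<tau>' = \<tau> + of_nat N * of_int k" .
  qed
  finally show ?thesis .
qed

lemma q_param_surj:
  assumes "N > 0" "q \<noteq> 0"
  obtains \<tau> where "q_param N \<tau> = q"
proof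
  show "q_param N (of_nat N / (2 * pi * \<i>) * Ln q) = q"
    using assms by (simp add: q_param_def)
qed

text \<open>The half planes Im > y are the preimages of punctured discs about 0, so limits at the
  cusp become limits in q. The filter \<open>at 0\<close> leaves out the centre, which q never
  attains.\<close>

lemma eventually_at_0_q_param:
  assumes "N > 0"
  shows "eventually P (at 0) \<longleftrightarrow> (\<forall>\<^sub>F \<tau> in Im_at_top. P (q_param N \<tau>))"
proof
  assume "eventually P (at 0)"
  then obtain e where e: "e > 0" "\<And>q. q \<noteq> 0 \<Longrightarrow> norm q < e \<Longrightarrow> P q"
    by (auto simp: eventually_at)
  define y where "y = - ln e * N / (2 * pi)"
  have "exp (- (2 * pi / N * y)) = e" using e(1) assms by (simp add: y_def)
  then have "P (q_param N \<tau>)" if "Im \<tau> > y" for \<tau>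
    using that norm_q_param_less_iff[OF assms, of \<tau> y] by (intro e(2)) auto
  then show "\<forall>\<^sub>F \<tau> in Im_at_top. P (q_param N \<tau>)" unfolding eventually_Im_at_top by blast
next
  assume "\<forall>\<^sub>F \<tau> in Im_at_top. P (q_param N \<tau>)"
  then obtain y where y: "\<And>\<tau>. Im \<tau> > y \<Longrightarrow> P (q_param N \<tau>)" unfolding eventually_Im_at_top by blast
  have "P q" if q: "q \<noteq> 0" "norm q < exp (- (2 * pi / N * y))" for q
  proof -
    obtain \<tau> where \<tau>: "q_param N \<tau> = q" using q_param_surj assms q(1) by blast
    with q(2) norm_q_param_less_iff[OF assms] have "Im \<tau> > y" by blast
    with y \<tau> show ?thesis by blast
  qed
  then show "eventually P (at 0)" unfolding eventually_at
    by (intro exI[of _ "exp (- (2 * pi / N * y))"]) (auto simp: dist_norm)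
qed

lemma filterlim_q_param_iff:
  assumes "N > 0"
  shows "filterlim F G (at 0) \<longleftrightarrow> filterlim (\<lambda>\<tau>. F (q_param N \<tau>)) G Im_at_top"
  unfolding filterlim_iff using eventually_at_0_q_param[OF assms] by simp

lemma holomorphic_q_param: "q_param N holomorphic_on S"
  unfolding q_param_def by (intro holomorphic_intros)

text \<open>Near q0 the quotient q / q0 stays near 1, where \<open>Ln\<close> is holomorphic. This
  gives a local holomorphic section g of q, and by periodicity the descended function is u composed
  with g there, whichever preimage the choice operator picks.\<close>

lemma descend_q_param:
  assumes N: "N > 0" and hol: "u holomorphic_on {\<tau>. Im \<tau> > y}"
    and per: "\<And>\<tau> \<tau>'. Im \<tau> > y \<Longrightarrow> Im \<tau>' > y \<Longrightarrow> q_param N \<tau> = q_param N \<tau>' \<Longrightarrow> u \<tau> = u \<tau>'"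
  obtains F where "F holomorphic_on ball 0 (exp (- (2 * pi / N * y))) - {0}"
    "\<And>\<tau>. Im \<tau> > y \<Longrightarrow> F (q_param N \<tau>) = u \<tau>"
proof
  define r where "r = exp (- (2 * pi / N * y))"
  define F where "F q = u (SOME \<tau>. q_param N \<tau> = q)" for q
  have r: "norm (q_param N \<tau>) < r \<longleftrightarrow> Im \<tau> > y" for \<tau>
    unfolding r_def by (rule norm_q_param_less_iff[OF N])
  show F: "F (q_param N \<tau>) = u \<tau>" if "Im \<tau> > y" for \<tau>
  proof -
    have *: "q_param N (SOME \<sigma>. q_param N \<sigma> = q_param N \<tau>) = q_param N \<tau>"
      by (rule someI[of _ \<tau>]) simp
    have "Im (SOME \<sigma>. q_param N \<sigma> = q_param N \<tau>) > y"
      using r[of "SOME \<sigma>. q_param N \<sigma> = q_param N \<tau>"] r[of \<tau>] that unfolding * by simp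
    then show ?thesis unfolding F_def using that * by (intro per) auto
  qed
  have "F field_differentiable at q0" if q0: "q0 \<in> ball 0 r - {0}" for q0
  proof -
    obtain \<tau>0 where \<tau>0: "q_param N \<tau>0 = q0" using q_param_surj[OF N] q0 by blast
    define g where "g q = \<tau>0 + of_nat N / (2 * pi * \<i>) * Ln (q / q0)" for q
    have gq: "q_param N (g q) = q" if "q \<noteq> 0" for q
      using that N q0 by (simp add: g_def q_param_add \<tau>0) (simp add: q_param_def)
    have g0: "g q0 = \<tau>0" using q0 by (simp add: g_def)
    have "Im \<tau>0 > y" using r[of \<tau>0] q0 \<tau>0 by simp
    then have "u field_differentiable at (g q0)"
      unfolding g0 by (intro holomorphic_on_imp_differentiable_at[OF hol]) (auto simp: open_halfspace_Im_gt)
    moreover have "q0 \<noteq> 0" using q0 by simp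
    then have "g field_differentiable at q0"
      unfolding g_def field_differentiable_def
      by (intro exI) (rule derivative_eq_intros refl | simp)+
    ultimately have "(u \<circ> g) field_differentiable at q0" by (intro field_differentiable_compose)
    moreover have "\<forall>\<^sub>F q in nhds q0. (u \<circ> g) q = F q"
    proof -
      have "\<forall>\<^sub>F q in nhds q0. q \<in> ball 0 r - {0}"
        using q0 by (intro eventually_nhds_in_open) auto
      then show ?thesis
      proof eventually_elim
        case (elim q)
        then have "Im (g q) > y" using gq[of q] r[of "g q"] by auto
        from F[OF this] show ?case using gq[of q] elim by simp
      qed
    qed
    ultimately show ?thesis
      unfolding field_differentiable_def using DERIV_cong_ev by blast
  qed
  then show "F holomorphic_on ball 0 (exp (- (2 * pi / N * y))) - {0}"
    unfolding r_def[symmetric] holomorphic_on_def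
    by (meson field_differentiable_at_within)
qed

text \<open>The open mapping theorem for the extension of F by l. The value l is left out because
  the extension may take it at the centre only.\<close>

lemma holomorphic_punctured_values:
  assumes F: "F holomorphic_on ball 0 r - {0}" and r: "r > 0" and lim: "(F \<longlongrightarrow> l) (at 0)"
    and nonconst: "\<And>\<epsilon>. \<epsilon> > 0 \<Longrightarrow> \<exists>q. q \<noteq> 0 \<and> norm q < \<epsilon> \<and> F q \<noteq> l" and "\<epsilon> > 0"
  shows "\<forall>\<^sub>F w in at l. \<exists>q. q \<noteq> 0 \<and> norm q < \<epsilon> \<and> F q = w"
proof -
  define G where "G = (\<lambda>q. if q = 0 then l else F q)"
  have G: "G holomorphic_on ball 0 r"
    unfolding G_def by (rule removable_singularity[OF F open_ball lim])
  define s where "s = min r \<epsilon>"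
  have s: "s > 0" "s \<le> r" "s \<le> \<epsilon>" using r \<open>\<epsilon> > 0\<close> by (auto simp: s_def)
  have "\<not> G constant_on ball 0 r"
  proof
    assume "G constant_on ball 0 r"
    then obtain k where k: "\<And>q. q \<in> ball 0 r \<Longrightarrow> G q = k" by (auto simp: constant_on_def)
    obtain q where q: "q \<noteq> 0" "norm q < r" "F q \<noteq> l" using nonconst[OF r] by blast
    with k[of q] k[of 0] r show False by (simp add: G_def)
  qed
  then have "open (G ` ball 0 s)"
    by (intro open_mapping_thm[OF G]) (use s in auto)
  moreover have "l \<in> G ` ball 0 s" using s by (auto simp: G_def image_iff intro!: bexI[of _ 0])
  ultimately have "\<forall>\<^sub>F w in nhds l. w \<in> G ` ball 0 s" by (rule eventually_nhds_in_open)
  then have "\<forall>\<^sub>F w in at l. w \<in> G ` ball 0 s \<and> w \<noteq> l"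
    unfolding eventually_at_filter by eventually_elim auto
  then show ?thesis
  proof eventually_elim
    case (elim w)
    then obtain q where q: "q \<in> ball 0 s" "w = G q" "w \<noteq> l" by blast
    then have "q \<noteq> 0" "F q = w" by (auto simp: G_def split: if_splits)
    with q(1) s(3) show ?case by (intro exI[of _ q]) auto
  qed
qed

section \<open>Coverings by the upper half plane and the cusp at infinity\<close>

text \<open>The neighbourhood is a sheet over an evenly covered set around p \<tau>; it is open in
  the ambient space because S is.\<close>

lemma covering_space_locally_injective:
  assumes cov: "covering_space S p \<Omega>" and "open S" "\<tau> \<in> S"
  obtains U where "open U" "\<tau> \<in> U" "U \<subseteq> S" "inj_on p U"
proof -
  have "p \<tau> \<in> \<Omega>" using cov assms(3) by (auto simp: covering_space_def)
  have "\<forall>x \<in> \<Omega>. \<exists>T. x \<in> T \<and> openin (top_of_set \<Omega>) T \<and>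
          (\<exists>v. \<Union>v = S \<inter> p -` T \<and> (\<forall>u \<in> v. openin (top_of_set S) u) \<and>
               pairwise disjnt v \<and> (\<forall>u \<in> v. \<exists>q. homeomorphism u T p q))"
    using cov by (simp add: covering_space_def)
  from bspec[OF this \<open>p \<tau> \<in> \<Omega>\<close>] obtain T v where T: "p \<tau> \<in> T" "\<Union>v = S \<inter> p -` T"
    "\<forall>u \<in> v. openin (top_of_set S) u" "\<forall>u \<in> v. \<exists>q. homeomorphism u T p q"
    by (elim exE conjE)
  have "\<tau> \<in> \<Union>v" using T(1,2) assms(3) by auto
  then obtain u where u: "u \<in> v" "\<tau> \<in> u" by blast
  then have "open u" "u \<subseteq> S"
    using T(3) \<open>open S\<close> by (simp_all add: openin_open_eq)
  moreover obtain q where "homeomorphism u T p q" using T(4) u(1) by blast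
  then have "inj_on p u" by (meson homeomorphism_def inj_on_inverseI)
  ultimately show thesis using u(2) that by blast
qed

text \<open>The topological lift is locally the composite of p' with a holomorphic inverse of p,
  taken on a neighbourhood where p is injective.\<close>

lemma holomorphic_lift:
  assumes S: "open S" "S \<noteq> {}" and hol: "p holomorphic_on S" and cov: "covering_space S p \<Omega>"
    and U: "open U" "simply_connected U" and hol': "p' holomorphic_on U" and im: "p' ` U \<subseteq> \<Omega>"
    and z: "z \<in> U" and a: "a \<in> S" and eq: "p' z = p a"
  obtains \<Phi> where "\<Phi> holomorphic_on U" "\<Phi> ` U \<subseteq> S" "\<Phi> z = a" "\<And>\<tau>. \<tau> \<in> U \<Longrightarrow> p (\<Phi> \<tau>) = p' \<tau>"
proof -
  obtain \<Phi> where \<Phi>: "continuous_on U \<Phi>" "\<Phi> \<in> U \<rightarrow> S" "\<Phi> z = a" "\<And>y. y \<in> U \<Longrightarrow> p (\<Phi> y) = p' y"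
    using covering_space_lift_strong[OF cov a z U(2) open_imp_locally_path_connected[OF U(1)]
      holomorphic_on_imp_continuous_on[OF hol'] _ eq] im by blast
  have "\<Phi> field_differentiable at \<tau>" if \<tau>: "\<tau> \<in> U" for \<tau>
  proof -
    have "\<Phi> \<tau> \<in> S" using \<Phi>(2) \<tau> by auto
    then obtain V where V: "open V" "\<Phi> \<tau> \<in> V" "V \<subseteq> S" "inj_on p V"
      using covering_space_locally_injective[OF cov S(1)] by blast
    then obtain g where g: "g holomorphic_on (p ` V)" "\<And>z. z \<in> V \<Longrightarrow> g (p z) = z"
      using holomorphic_has_inverse[of p V] holomorphic_on_subset[OF hol] by metis
    have "open (p ` V)"
      by (rule open_mapping_thm3[OF holomorphic_on_subset[OF hol V(3)] V(1,4)])
    moreover have "p' \<tau> \<in> p ` V" using V(2) \<Phi>(4)[OF \<tau>] by (metis image_eqI)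
    ultimately have "g field_differentiable at (p' \<tau>)"
      by (intro holomorphic_on_imp_differentiable_at[OF g(1)])
    then have 1: "(g \<circ> p') field_differentiable at \<tau>"
      using holomorphic_on_imp_differentiable_at[OF hol' U(1) \<tau>] by (intro field_differentiable_compose)
    have "open (U \<inter> \<Phi> -` V)"
      by (rule continuous_open_preimage[OF \<Phi>(1) U(1) V(1)])
    then have "\<forall>\<^sub>F w in nhds \<tau>. w \<in> U \<inter> \<Phi> -` V"
      using \<tau> V(2) by (intro eventually_nhds_in_open) auto
    then have "\<forall>\<^sub>F w in nhds \<tau>. (g \<circ> p') w = \<Phi> w"
      by eventually_elim (use g(2) \<Phi>(4) in force)
    with 1 show ?thesis
      unfolding field_differentiable_def using DERIV_cong_ev by blast
  qed
  then have "\<Phi> holomorphic_on U"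
    unfolding holomorphic_on_def by (meson field_differentiable_at_within)
  with \<Phi> show thesis by (intro that[of \<Phi>]) auto
qed

lemma simply_connected_upper_half_plane: "simply_connected \<H>"
  by (rule convex_imp_simply_connected[OF convex_upper_half_plane])

text \<open>What is kept of \<open>level_covering\<close> after the passage to p = 1 / f. Together,
  \<open>invariant\<close> and \<open>fibre\<close> say that the fibres are the orbits of the group;
  they are phrased with matrices so that concrete ones can be inserted. The axiom
  \<open>finite_compl\<close> serves the removal of singularities, \<open>two_omitted\<close> the
  great Picard theorem.\<close>

locale cusp_covering =
  fixes N :: nat and \<Omega> :: "complex set" and p :: "complex \<Rightarrow> complex"
  assumes N_pos: "N > 0"
    and holo: "p holomorphic_on \<H>"
    and cov: "covering_space \<H> p \<Omega>"
    and invariant: "\<And>M \<tau>. M \<in> principal_congruence_matrices N \<Longrightarrow> \<tau> \<in> \<H> \<Longrightarrow> p (moebius M \<tau>) = p \<tau>"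
    and fibre: "\<And>\<tau> \<tau>'. \<tau> \<in> \<H> \<Longrightarrow> \<tau>' \<in> \<H> \<Longrightarrow> p \<tau> = p \<tau>' \<Longrightarrow>
                  \<exists>M\<in>principal_congruence_matrices N. \<tau>' = moebius M \<tau>"
    and at_cusp: "filterlim p at_infinity Im_at_top"
    and finite_compl: "finite (- \<Omega>)"
    and two_omitted: "\<exists>a b. a \<noteq> b \<and> a \<notin> \<Omega> \<and> b \<notin> \<Omega>"
begin

lemma in_range: "\<tau> \<in> \<H> \<Longrightarrow> p \<tau> \<in> \<Omega>"
  using cov by (auto simp: covering_space_def)

lemma surj: "w \<in> \<Omega> \<Longrightarrow> \<exists>\<tau>\<in>\<H>. p \<tau> = w"
  using cov by (auto simp: covering_space_def)

lemma translation_invariant: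
  assumes "\<tau> \<in> \<H>"
  shows "p (\<tau> + of_nat N * of_int k) = p \<tau>"
proof -
  have "mat2 1 (int N * k) 0 1 \<in> principal_congruence_matrices N"
    by (rule mat2_in_principal) (auto simp: cong_0_iff)
  from invariant[OF this assms] show ?thesis by (simp add: moebius_mat2)
qed

lemma q_invariant:
  assumes "\<tau> \<in> \<H>" "q_param N \<tau> = q_param N \<tau>'"
  shows "p \<tau> = p \<tau>'"
  using assms translation_invariant q_param_eq_iff[OF N_pos] by metis

text \<open>The heights force c = 0, so the diagonal entries are both 1 or both -1 and the matrix
  acts as a translation by a multiple of N.\<close>

lemma horoball_fibre:
  assumes "Im \<tau> > 1" "Im \<tau>' \<ge> 1" "p \<tau> = p \<tau>'"
  shows "q_param N \<tau> = q_param N \<tau>'"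
proof -
  obtain M where M: "M \<in> principal_congruence_matrices N" "\<tau>' = moebius M \<tau>"
    using fibre[of \<tau> \<tau>'] assms by (auto simp: in_upper_half_plane_iff)
  from M(1) obtain a b c d :: int where abcd: "\<And>\<tau>. moebius M \<tau> = (of_int a * \<tau> + of_int b) / (of_int c * \<tau> + of_int d)"
    "a * d - b * c = 1" "int N dvd b"
    by (rule principal_congruence_cases) metis
  have "c = 0" using moebius_horoball[OF abcd(2) assms(1)] assms(2) M(2) abcd(1) by simp
  with abcd(2) have ad: "a * d = 1" by simp
  from abcd(3) obtain k where k: "b = int N * k" by auto
  from ad have "a = d" "d = 1 \<or> d = -1" by (auto simp: zmult_eq_1_iff)
  then have "\<tau>' = \<tau> + of_nat N * of_int (d * k)"
    using M(2) abcd(1)[of \<tau>] \<open>c = 0\<close> k by auto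
  with q_param_eq_iff[OF N_pos] show ?thesis by blast
qed

text \<open>By \<open>horoball_fibre\<close> the function of q to which 1 / p descends is injective
  near 0, and an injective holomorphic function has nonzero derivative; so the zero at the cusp is
  simple.\<close>

lemma cusp_expansion:
  obtains F r where "r > 0" "F holomorphic_on ball 0 r" "F 0 = 0" "deriv F 0 \<noteq> 0"
    "\<And>\<tau>. norm (q_param N \<tau>) < r \<Longrightarrow> Im \<tau> > 1 \<and> p \<tau> \<noteq> 0 \<and> F (q_param N \<tau>) = 1 / p \<tau>"
proof -
  have "\<forall>\<^sub>F \<tau> in Im_at_top. 1 \<le> norm (p \<tau>)"
    using at_cusp unfolding filterlim_at_infinity[OF order.refl] by simp
  then have "\<forall>\<^sub>F \<tau> in Im_at_top. p \<tau> \<noteq> 0 \<and> Im \<tau> > 1"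
    using eventually_Im_at_top_gt[of 1] by eventually_elim auto
  then obtain y0 where y0: "\<And>\<tau>. Im \<tau> > y0 \<Longrightarrow> p \<tau> \<noteq> 0 \<and> Im \<tau> > 1"
    unfolding eventually_Im_at_top by blast
  define r where "r = exp (- (2 * pi / N * y0))"
  have r: "norm (q_param N \<tau>) < r \<longleftrightarrow> Im \<tau> > y0" for \<tau>
    unfolding r_def by (rule norm_q_param_less_iff[OF N_pos])
  have "(\<lambda>\<tau>. 1 / p \<tau>) holomorphic_on {\<tau>. Im \<tau> > y0}"
    by (intro holomorphic_intros holomorphic_on_subset[OF holo])
       (use y0 in \<open>force simp: in_upper_half_plane_iff\<close>)+
  moreover have "1 / p \<tau> = 1 / p \<tau>'" if "Im \<tau> > y0" "q_param N \<tau> = q_param N \<tau>'" for \<tau> \<tau>'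
    using q_invariant[OF _ that(2)] y0[OF that(1)] by (simp add: in_upper_half_plane_iff)
  ultimately obtain F where F: "F holomorphic_on ball 0 r - {0}"
    "\<And>\<tau>. Im \<tau> > y0 \<Longrightarrow> F (q_param N \<tau>) = 1 / p \<tau>"
    using descend_q_param[OF N_pos, of "\<lambda>\<tau>. 1 / p \<tau>" y0] unfolding r_def by metis
  have "((\<lambda>\<tau>. 1 / p \<tau>) \<longlongrightarrow> 0) Im_at_top"
    using filterlim_compose[OF tendsto_inverse_0 at_cusp] by (simp add: inverse_eq_divide)
  moreover have "\<forall>\<^sub>F \<tau> in Im_at_top. 1 / p \<tau> = F (q_param N \<tau>)"
    using eventually_Im_at_top_gt[of y0] by eventually_elim (use F(2) in simp)
  ultimately have "((\<lambda>\<tau>. F (q_param N \<tau>)) \<longlongrightarrow> 0) Im_at_top"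
    by (rule Lim_transform_eventually)
  then have lim: "(F \<longlongrightarrow> 0) (at 0)" by (simp add: filterlim_q_param_iff[OF N_pos])
  define G where "G = (\<lambda>q. if q = 0 then 0 else F q)"
  have G: "G holomorphic_on ball 0 r" unfolding G_def
    by (rule removable_singularity[OF F(1) open_ball lim])
  have Gq: "G (q_param N \<tau>) = 1 / p \<tau>" "p \<tau> \<noteq> 0" "Im \<tau> > 1" if "norm (q_param N \<tau>) < r" for \<tau>
    using that r F(2) y0 by (auto simp: G_def)
  have "inj_on G (ball 0 r)"
  proof (rule inj_onI)
    fix q q' assume q: "q \<in> ball 0 r" "q' \<in> ball 0 r" "G q = G q'"
    \<comment> \<open>Away from the centre, G is a reciprocal of a nonzero value of p.\<close>
    have nz: "G s \<noteq> 0" if "s \<noteq> 0" "s \<in> ball 0 r" for s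
    proof -
      obtain \<tau> where "q_param N \<tau> = s" using q_param_surj[OF N_pos \<open>s \<noteq> 0\<close>] by blast
      with Gq[of \<tau>] that show ?thesis by auto
    qed
    show "q = q'"
    proof (cases "q = 0 \<or> q' = 0")
      case True
      then have "G q = 0" "G q' = 0" using q(3) by (auto simp: G_def)
      with nz[of q] nz[of q'] q(1,2) show ?thesis by blast
    next
      case False
      then obtain \<tau> \<tau>' where "q_param N \<tau> = q" "q_param N \<tau>' = q'"
        using q_param_surj[OF N_pos] by metis
      with Gq[of \<tau>] Gq[of \<tau>'] q horoball_fibre[of \<tau> \<tau>'] show ?thesis by auto
    qed
  qed
  then have "deriv G 0 \<noteq> 0"
    by (intro holomorphic_injective_imp_regular[OF G]) (auto simp: r_def)
  with G Gq show thesis by (intro that[of r G]) (auto simp: r_def G_def)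
qed

text \<open>Open mapping at the cusp: small values of 1 / p are all taken on an arbitrarily small
  disc in q, that is, above any height Y.\<close>

lemma large_values:
  obtains R where "R > 0" "\<And>w. norm w > R \<Longrightarrow> \<exists>\<tau>. Im \<tau> > Y \<and> p \<tau> = w"
proof -
  obtain F r where F: "r > 0" "F holomorphic_on ball 0 r" "F 0 = 0" "deriv F 0 \<noteq> 0"
    "\<And>\<tau>. norm (q_param N \<tau>) < r \<Longrightarrow> Im \<tau> > 1 \<and> p \<tau> \<noteq> 0 \<and> F (q_param N \<tau>) = 1 / p \<tau>"
    by (rule cusp_expansion) blast
  define e where "e = min r (exp (- (2 * pi / N * Y)))"
  have "e > 0" using F(1) by (auto simp: e_def)
  have "isCont F 0"
    using F(1,2) by (metis centre_in_ball continuous_on_interior holomorphic_on_imp_continuous_on interior_ball)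
  then have lim: "(F \<longlongrightarrow> 0) (at 0)" using F(3) by (simp add: isCont_def)
  have nc: "\<exists>q. q \<noteq> 0 \<and> norm q < \<epsilon> \<and> F q \<noteq> 0" if "\<epsilon> > 0" for \<epsilon>
  proof -
    define q where "q = complex_of_real (min \<epsilon> r / 2)"
    have q: "q \<noteq> 0" "norm q < \<epsilon>" "norm q < r" using that F(1) by (auto simp: q_def)
    then obtain \<tau> where "q_param N \<tau> = q" using q_param_surj[OF N_pos] by blast
    with F(5)[of \<tau>] q show ?thesis by (intro exI[of _ q]) auto
  qed
  have "\<forall>\<^sub>F w in at 0. \<exists>q. q \<noteq> 0 \<and> norm q < e \<and> F q = w"
    by (rule holomorphic_punctured_values[OF _ F(1) lim nc \<open>e > 0\<close>])
       (use F(2) holomorphic_on_subset in blast)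
  then obtain \<delta> where \<delta>: "\<delta> > 0" "\<And>w. w \<noteq> 0 \<Longrightarrow> norm w < \<delta> \<Longrightarrow> \<exists>q. q \<noteq> 0 \<and> norm q < e \<and> F q = w"
    by (auto simp: eventually_at)
  show thesis
  proof (rule that[of "1 / \<delta>"])
    show "1 / \<delta> > 0" using \<delta>(1) by simp
    fix w :: complex assume w: "norm w > 1 / \<delta>"
    have "0 < 1 / \<delta>" using \<delta>(1) by simp
    with w have nw: "norm w > 0" by linarith
    then have "w \<noteq> 0" "norm (1 / w) < \<delta>" using w \<delta>(1) by (auto simp: norm_divide field_simps)
    then obtain q where q: "q \<noteq> 0" "norm q < e" "F q = 1 / w" using \<delta>(2)[of "1 / w"] by auto
    obtain \<tau> where \<tau>: "q_param N \<tau> = q" using q_param_surj[OF N_pos q(1)] by blast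
    have "Im \<tau> > Y" using norm_q_param_less_iff[OF N_pos, of \<tau> Y] \<tau> q(2) by (simp add: e_def)
    moreover have "p \<tau> = w" using F(5)[of \<tau>] \<tau> q by (simp add: e_def)
    ultimately show "\<exists>\<tau>. Im \<tau> > Y \<and> p \<tau> = w" by blast
  qed
qed

end

text \<open>The substance is \<open>fibre\<close>: as the upper half plane is simply connected, the
  deck group acts transitively on fibres. Lifting p through itself gives a map taking z to a and one
  taking a to z; they are mutually inverse, so the first is a deck transformation and hence comes
  from a congruence matrix.\<close>

lemma level_covering_imp_cusp_covering:
  assumes lev: "level_covering N n P f" and N: "N > 0" and n: "n \<ge> 3"
  defines "p \<equiv> chart_infty \<circ> f"
  shows "cusp_covering N {w. inv_chart w \<notin> P} p" "\<And>\<tau>. \<tau> \<in> \<H> \<Longrightarrow> f \<tau> = inv_chart (p \<tau>)"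
proof -
  have P: "finite P" "card P = n" "Fin 0 \<in> P" and cov: "covering_space \<H> f (- P)"
    and hol: "holomorphic_map_cp1 \<H> f" and deck: "deck_group f = Gamma_group N"
    and van: "(f \<longlongrightarrow> Fin 0) Im_at_top"
    using lev by (auto simp: level_covering_def universal_covering_def vanishes_at_infinity_def)
  let ?\<Omega> = "{w. inv_chart w \<notin> P}"
  have fP: "f \<tau> \<notin> P" if "\<tau> \<in> \<H>" for \<tau>
    using cov that by (auto simp: covering_space_def)
  then have f0: "f \<tau> \<noteq> Fin 0" if "\<tau> \<in> \<H>" for \<tau>
    using that P(3) by metis
  show fp: "f \<tau> = inv_chart (p \<tau>)" if "\<tau> \<in> \<H>" for \<tau>
    unfolding p_def o_def using f0[OF that] by (rule inv_chart_chart_infty[symmetric])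
  have img: "chart_infty ` (- P) = ?\<Omega>"
  proof (intro equalityI subsetI)
    fix w assume "w \<in> chart_infty ` (- P)"
    then obtain x where x: "x \<notin> P" "w = chart_infty x" by auto
    then have "x \<noteq> Fin 0" using P(3) by metis
    then show "w \<in> ?\<Omega>" using x by (simp add: inv_chart_chart_infty)
  next
    fix w assume "w \<in> ?\<Omega>"
    then show "w \<in> chart_infty ` (- P)" by (intro image_eqI[of _ _ "inv_chart w"]) auto
  qed
  have "homeomorphism (- P) ?\<Omega> chart_infty inv_chart"
    by (rule homeomorphism_of_subsets[OF homeomorphism_chart_infty _ subset_UNIV img]) (use P(3) in auto)
  from covering_space_compose_homeomorphism[OF cov this]
  have covp: "covering_space \<H> p ?\<Omega>" unfolding p_def .
  have holp: "p holomorphic_on \<H>"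
    unfolding holomorphic_on_def
  proof
    fix z assume z: "z \<in> \<H>"
    with hol obtain U where U: "open U" "z \<in> U" "U \<subseteq> \<H>"
      "(Infty \<notin> f ` U \<and> (chart_0 \<circ> f) holomorphic_on U) \<or>
       (Fin 0 \<notin> f ` U \<and> (chart_infty \<circ> f) holomorphic_on U)"
      unfolding holomorphic_map_cp1_def by blast
    have "p holomorphic_on U"
      using U(4)
    proof
      assume *: "Infty \<notin> f ` U \<and> (chart_0 \<circ> f) holomorphic_on U"
      \<comment> \<open>Since 0 is a puncture, the standard coordinate of f does not vanish, and p
        is its reciprocal.\<close>
      have nz: "chart_0 (f x) \<noteq> 0 \<and> p x = 1 / chart_0 (f x)" if "x \<in> U" for x
        using f0[of x] * U(3) that unfolding p_def by (cases "f x") (auto simp: image_iff)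
      have "(\<lambda>x. 1 / (chart_0 \<circ> f) x) holomorphic_on U"
        by (intro holomorphic_intros conjunct2[OF *]) (use nz in auto)
      then show ?thesis by (rule holomorphic_transform) (use nz in auto)
    qed (simp add: p_def)
    then have "p field_differentiable at z"
      using U(1,2) by (intro holomorphic_on_imp_differentiable_at)
    then show "p field_differentiable at z within \<H>" by (rule field_differentiable_at_within)
  qed
  have deck_iff: "f (moebius M \<tau>) = f \<tau>" "moebius M \<tau> \<in> \<H>"
    if "M \<in> principal_congruence_matrices N" "\<tau> \<in> \<H>" for M \<tau>
  proof -
    have "restrict (moebius M) \<H> \<in> deck_group f"
      unfolding deck Gamma_group_def using that(1) by blast
    then have *: "restrict (moebius M) \<H> \<in> Aut_upper_half_plane"
      "f (restrict (moebius M) \<H> \<tau>) = f \<tau>"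
      using that(2) unfolding deck_group_def by auto
    from *(1) have "bij_betw (restrict (moebius M) \<H>) \<H> \<H>"
      unfolding Aut_upper_half_plane_def by blast
    then have "restrict (moebius M) \<H> \<tau> \<in> \<H>" using that(2) bij_betwE by blast
    with *(2) that(2) show "f (moebius M \<tau>) = f \<tau>" "moebius M \<tau> \<in> \<H>" by simp_all
  qed
  show "cusp_covering N ?\<Omega> p"
  proof
    show "N > 0" by (rule N)
    show "p holomorphic_on \<H>" by (rule holp)
    show "covering_space \<H> p ?\<Omega>" by (rule covp)
    show "p (moebius M \<tau>) = p \<tau>" if "M \<in> principal_congruence_matrices N" "\<tau> \<in> \<H>" for M \<tau>
      using deck_iff(1)[OF that] by (simp add: p_def)
    show "filterlim p at_infinity Im_at_top"
      unfolding p_def o_def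
    proof (rule filterlim_chart_infty_at_infinity[OF van])
      show "\<forall>\<^sub>F \<tau> in Im_at_top. f \<tau> \<noteq> Fin 0"
        using eventually_Im_at_top_gt[of 0]
        by eventually_elim (use f0 in_upper_half_plane_iff in blast)
    qed
    have compl: "- ?\<Omega> = chart_infty ` (P - {Fin 0})"
    proof (intro equalityI subsetI)
      fix w assume "w \<in> - ?\<Omega>"
      then have "inv_chart w \<in> P - {Fin 0}" using inv_chart_neq_0[of w] by blast
      then show "w \<in> chart_infty ` (P - {Fin 0})"
        by (intro image_eqI[of _ _ "inv_chart w"]) simp_all
    next
      fix w assume "w \<in> chart_infty ` (P - {Fin 0})"
      then obtain x where x: "x \<in> P" "x \<noteq> Fin 0" "w = chart_infty x" by blast
      then show "w \<in> - ?\<Omega>" by (simp add: inv_chart_chart_infty)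
    qed
    show fin: "finite (- ?\<Omega>)" unfolding compl using P(1) by simp
    have "inj_on chart_infty (P - {Fin 0})"
      by (rule inj_on_inverseI[of _ inv_chart]) (use inv_chart_chart_infty in blast)
    \<comment> \<open>The puncture 0 of the sphere has moved to infinity. The other n - 1 are finite
      in the new coordinate, where a puncture \<open>Infty\<close> becomes 0.\<close>
    then have "card (- ?\<Omega>) = n - 1"
      unfolding compl using P by (simp add: card_image)
    then have "2 \<le> card (- ?\<Omega>)" using n by simp
    then obtain B where B: "B \<subseteq> - ?\<Omega>" "card B = 2" by (rule obtain_subset_with_card_n) blast
    then obtain a b where "B = {a, b}" "a \<noteq> b" by (meson card_2_iff)
    with B(1) show "\<exists>a b. a \<noteq> b \<and> a \<notin> ?\<Omega> \<and> b \<notin> ?\<Omega>"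
      by (intro exI[of _ a] exI[of _ b]) simp
    fix z a assume za: "z \<in> \<H>" "a \<in> \<H>" "p z = p a"
    have im: "p ` \<H> \<subseteq> ?\<Omega>" using covp by (auto simp: covering_space_def)
    have ne: "\<H> \<noteq> {}" using za(1) by blast
    obtain \<Phi> where \<Phi>: "\<Phi> holomorphic_on \<H>" "\<Phi> ` \<H> \<subseteq> \<H>" "\<Phi> z = a" "\<And>\<tau>. \<tau> \<in> \<H> \<Longrightarrow> p (\<Phi> \<tau>) = p \<tau>"
      using holomorphic_lift[OF open_upper_half_plane ne holp covp open_upper_half_plane
          simply_connected_upper_half_plane holp im za] by metis
    obtain \<Psi> where \<Psi>: "\<Psi> holomorphic_on \<H>" "\<Psi> ` \<H> \<subseteq> \<H>" "\<Psi> a = z" "\<And>\<tau>. \<tau> \<in> \<H> \<Longrightarrow> p (\<Psi> \<tau>) = p \<tau>"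
      using holomorphic_lift[OF open_upper_half_plane ne holp covp open_upper_half_plane
          simply_connected_upper_half_plane holp im za(2,1) za(3)[symmetric]] by metis
    \<comment> \<open>A composite of two lifts of p through itself is another such lift; it agrees
      with the identity at x, hence everywhere by uniqueness of lifts.\<close>
    have id: "\<beta> (\<alpha> \<tau>) = \<tau>" if "\<alpha> holomorphic_on \<H>" "\<alpha> ` \<H> \<subseteq> \<H>" "\<And>\<tau>. \<tau> \<in> \<H> \<Longrightarrow> p (\<alpha> \<tau>) = p \<tau>"
      "\<beta> holomorphic_on \<H>" "\<beta> ` \<H> \<subseteq> \<H>" "\<And>\<tau>. \<tau> \<in> \<H> \<Longrightarrow> p (\<beta> \<tau>) = p \<tau>"
      "x \<in> \<H>" "\<beta> (\<alpha> x) = x" "\<tau> \<in> \<H>" for \<alpha> \<beta> x \<tau>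
    proof (rule covering_space_lift_unique[OF covp, of "\<lambda>\<tau>. \<beta> (\<alpha> \<tau>)" x "\<lambda>\<tau>. \<tau>" \<H> p])
      show "continuous_on \<H> (\<lambda>\<tau>. \<beta> (\<alpha> \<tau>))"
        by (rule continuous_on_compose2[OF holomorphic_on_imp_continuous_on[OF that(4)]
              holomorphic_on_imp_continuous_on[OF that(1)] that(2)])
      show "continuous_on \<H> p" using holp by (rule holomorphic_on_imp_continuous_on)
      show "connected \<H>" by (rule convex_connected[OF convex_upper_half_plane])
      show "p \<in> \<H> \<rightarrow> ?\<Omega>" using im by blast
      show "p t = p (\<beta> (\<alpha> t))" if "t \<in> \<H>" for t
      proof -
        have "\<alpha> t \<in> \<H>" using that \<open>\<alpha> ` \<H> \<subseteq> \<H>\<close> by blast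
        then show ?thesis using that \<open>\<And>\<tau>. \<tau> \<in> \<H> \<Longrightarrow> p (\<beta> \<tau>) = p \<tau>\<close> \<open>\<And>\<tau>. \<tau> \<in> \<H> \<Longrightarrow> p (\<alpha> \<tau>) = p \<tau>\<close> by simp
      qed
    qed (use that in auto)
    have \<Psi>\<Phi>: "\<Psi> (\<Phi> \<tau>) = \<tau>" if "\<tau> \<in> \<H>" for \<tau>
      by (rule id[OF \<Phi>(1,2,4) \<Psi>(1,2,4) za(1) _ that]) (simp_all add: \<Phi> \<Psi>)
    have \<Phi>\<Psi>: "\<Phi> (\<Psi> \<tau>) = \<tau>" if "\<tau> \<in> \<H>" for \<tau>
      by (rule id[OF \<Psi>(1,2,4) \<Phi>(1,2,4) za(2) _ that]) (simp_all add: \<Phi> \<Psi>)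
    have bij: "bij_betw (restrict \<Phi> \<H>) \<H> \<H>"
      by (rule bij_betwI[of _ _ _ \<Psi>]) (use \<Phi>(2) \<Psi>(2) \<Psi>\<Phi> \<Phi>\<Psi> in auto)
    have "restrict \<Phi> \<H> \<in> deck_group f"
      unfolding deck_group_def Aut_upper_half_plane_def
    proof (intro CollectI conjI ballI)
      show "restrict \<Phi> \<H> holomorphic_on \<H>"
        using \<Phi>(1) by (rule holomorphic_transform) simp
      show "inv_into \<H> (restrict \<Phi> \<H>) holomorphic_on \<H>"
      proof (rule holomorphic_transform[OF \<Psi>(1)])
        fix x assume x: "x \<in> \<H>"
        then have "\<Psi> x \<in> \<H>" using \<Psi>(2) by blast
        then show "\<Psi> x = inv_into \<H> (restrict \<Phi> \<H>) x"
          using bij x \<Phi>\<Psi>[OF x] by (intro inv_into_f_eq[symmetric]) (auto simp: bij_betw_def)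
      qed
      fix \<tau> assume \<tau>: "\<tau> \<in> \<H>"
      then have "\<Phi> \<tau> \<in> \<H>" using \<Phi>(2) by blast
      then show "f (restrict \<Phi> \<H> \<tau>) = f \<tau>" using \<tau> \<Phi>(4) fp by simp
    qed (use bij in auto)
    then obtain M where M: "M \<in> principal_congruence_matrices N" "restrict \<Phi> \<H> = restrict (moebius M) \<H>"
      unfolding deck Gamma_group_def by blast
    from M(2) have "restrict \<Phi> \<H> z = restrict (moebius M) \<H> z" by simp
    with za(1) \<Phi>(3) have "a = moebius M z" by simp
    with M(1) show "\<exists>M\<in>principal_congruence_matrices N. a = moebius M z" by blast
  qed
qed

section \<open>Uniqueness up to affine maps\<close>

text \<open>The orbits depend on N alone, which makes coverings with different punctures
  comparable.\<close>

lemma cusp_coverings_same_fibres: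
  assumes "cusp_covering N \<Omega> p" "cusp_covering N \<Omega>' p'" "\<tau> \<in> \<H>" "\<tau>' \<in> \<H>" "p \<tau> = p \<tau>'"
  shows "p' \<tau> = p' \<tau>'"
  using cusp_covering.fibre[OF assms(1,3-5)] cusp_covering.invariant[OF assms(2) _ assms(3)] by auto

text \<open>F q / q has a finite limit and G q / q a nonzero one. Applied to 1 / p and 1 / p' this
  bounds p' linearly by p near the cusp.\<close>

lemma simple_zeros_comparable:
  fixes F G :: "complex \<Rightarrow> complex"
  assumes "F holomorphic_on ball 0 r" "G holomorphic_on ball 0 r" "r > 0" "F 0 = 0" "G 0 = 0" "deriv G 0 \<noteq> 0"
  obtains C where "\<forall>\<^sub>F q in at 0. norm (F q) \<le> C * norm (G q)"
proof
  have lim: "((\<lambda>q. E q / q) \<longlongrightarrow> deriv E 0) (at 0)" if "E holomorphic_on ball 0 r" "E 0 = 0" for E :: "complex \<Rightarrow> complex"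
  proof -
    have "(E has_field_derivative deriv E 0) (at 0)"
      using that(1) by (rule holomorphic_derivI) (use assms in auto)
    with that(2) show ?thesis by (simp add: has_field_derivative_iff)
  qed
  let ?a = "norm (deriv F 0) + 1" and ?b = "norm (deriv G 0) / 2"
  have "\<forall>\<^sub>F q in at 0. norm (F q / q) < ?a"
    by (rule order_tendstoD[OF tendsto_norm[OF lim]]) (use assms in auto)
  moreover have "\<forall>\<^sub>F q in at 0. ?b < norm (G q / q)"
    by (rule order_tendstoD[OF tendsto_norm[OF lim]]) (use assms in auto)
  moreover have "\<forall>\<^sub>F q in at 0. q \<noteq> (0 :: complex)" by (simp add: eventually_at_filter)
  ultimately show "\<forall>\<^sub>F q in at 0. norm (F q) \<le> ?a / ?b * norm (G q)"
  proof eventually_elim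
    case (elim q)
    have b: "?b > 0" using assms by simp
    have "norm (F q) \<le> ?a * norm q" using elim(1,3) by (simp add: norm_divide field_simps)
    also have "\<dots> = ?a / ?b * (?b * norm q)" using b by simp
    also have "\<dots> \<le> ?a / ?b * norm (G q)"
    proof (rule mult_left_mono)
      show "?b * norm q \<le> norm (G q)"
        using elim(2,3) by (simp add: norm_divide field_simps)
      have "?a \<ge> 0" using norm_ge_zero[of "deriv F 0"] by linarith
      then show "?a / ?b \<ge> 0" using b by (intro divide_nonneg_pos)
    qed
    finally show ?case .
  qed
qed

text \<open>The induced map between the punctured planes is bounded near the punctures and grows
  at most linearly, hence is affine.\<close>

lemma cusp_coverings_affine:
  assumes "cusp_covering N \<Omega> p" "cusp_covering N \<Omega>' p'"
  obtains \<alpha> \<beta> where "\<alpha> \<noteq> 0" "\<And>\<tau>. \<tau> \<in> \<H> \<Longrightarrow> p' \<tau> = \<alpha> * p \<tau> + \<beta>"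
proof -
  interpret P: cusp_covering N \<Omega> p by fact
  interpret P': cusp_covering N \<Omega>' p' by fact
  define \<phi> where "\<phi> w = p' (SOME \<tau>. \<tau> \<in> \<H> \<and> p \<tau> = w)" for w
  have \<phi>: "\<phi> (p \<tau>) = p' \<tau>" if "\<tau> \<in> \<H>" for \<tau>
  proof -
    have "(SOME \<sigma>. \<sigma> \<in> \<H> \<and> p \<sigma> = p \<tau>) \<in> \<H> \<and> p (SOME \<sigma>. \<sigma> \<in> \<H> \<and> p \<sigma> = p \<tau>) = p \<tau>"
      by (rule someI[of _ \<tau>]) (use that in simp)
    then show ?thesis unfolding \<phi>_def
      using cusp_coverings_same_fibres[OF assms] that by metis
  qed
  have hol: "\<phi> holomorphic_on UNIV - (- \<Omega>)"
    unfolding holomorphic_on_def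
  proof
    fix w assume "w \<in> UNIV - (- \<Omega>)"
    then obtain \<tau> where \<tau>: "\<tau> \<in> \<H>" "p \<tau> = w" using P.surj[of w] by auto
    obtain U where U: "open U" "\<tau> \<in> U" "U \<subseteq> \<H>" "inj_on p U"
      using covering_space_locally_injective[OF P.cov open_upper_half_plane \<tau>(1)] by blast
    then obtain g where g: "g holomorphic_on (p ` U)" "\<And>z. z \<in> U \<Longrightarrow> g (p z) = z"
      using holomorphic_has_inverse[of p U] holomorphic_on_subset[OF P.holo] by metis
    have op: "open (p ` U)"
      by (rule open_mapping_thm3[OF holomorphic_on_subset[OF P.holo U(3)] U(1,4)])
    have "(p' \<circ> g) holomorphic_on p ` U"
      by (rule holomorphic_on_compose_gen[OF g(1) P'.holo]) (use g(2) U(3) in force)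
    then have "\<phi> holomorphic_on p ` U"
      by (rule holomorphic_transform) (use \<phi> g(2) U(3) in force)
    then have "\<phi> field_differentiable at w"
      using op \<tau>(2) U(2) by (intro holomorphic_on_imp_differentiable_at) auto
    then show "\<phi> field_differentiable at w within UNIV - (- \<Omega>)"
      by (rule field_differentiable_at_within)
  qed
  \<comment> \<open>A value of p' beyond R is also attained above height Y, where |p| exceeds r.
    Since both coverings have the same fibres, |p| <= r forces |p'| <= R.\<close>
  have bdd: "\<exists>R. \<forall>w\<in>\<Omega>. norm w \<le> r \<longrightarrow> norm (\<phi> w) \<le> R" for r
  proof -
    have "\<forall>\<^sub>F \<tau> in Im_at_top. \<bar>r\<bar> + 1 \<le> norm (p \<tau>)"
      using P.at_cusp unfolding filterlim_at_infinity[OF order.refl] by simp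
    then obtain Y where Y: "\<And>\<tau>. Im \<tau> > Y \<Longrightarrow> \<bar>r\<bar> + 1 \<le> norm (p \<tau>)"
      unfolding eventually_Im_at_top by blast
    obtain R where R: "R > 0" "\<And>w. norm w > R \<Longrightarrow> \<exists>\<tau>. Im \<tau> > max Y 0 \<and> p' \<tau> = w"
      using P'.large_values[of "max Y 0"] by blast
    have "norm (p' \<tau>) \<le> R" if "\<tau> \<in> \<H>" "norm (p \<tau>) \<le> r" for \<tau>
    proof (rule ccontr)
      assume "\<not> norm (p' \<tau>) \<le> R"
      then obtain \<tau>' where \<tau>': "Im \<tau>' > max Y 0" "p' \<tau>' = p' \<tau>" using R(2)[of "p' \<tau>"] by auto
      then have "p \<tau>' = p \<tau>"
        using that(1) by (intro cusp_coverings_same_fibres[OF assms(2,1)]) (simp_all add: in_upper_half_plane_iff)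
      with Y[of \<tau>'] \<tau>'(1) that(2) show False by auto
    qed
    then have "norm (\<phi> w) \<le> R" if "w \<in> \<Omega>" "norm w \<le> r" for w
      using P.surj[OF that(1)] that(2) \<phi> by auto
    then show ?thesis by blast
  qed
  \<comment> \<open>The punctures are finite in number, so a punctured neighbourhood of z contains
    none of them and \<open>bdd\<close> applies there.\<close>
  have "\<phi> \<in> O[at z](\<lambda>_. 1)" for z
  proof -
    obtain R where R: "\<And>w. w \<in> \<Omega> \<Longrightarrow> norm w \<le> norm z + 1 \<Longrightarrow> norm (\<phi> w) \<le> R"
      using bdd[of "norm z + 1"] by blast
    have "\<forall>\<^sub>F w in at z. w \<in> ball z 1"
      by (intro eventually_at_in_open') auto
    moreover have "open (- ((- \<Omega>) - {z}))"
      using P.finite_compl by (intro open_Compl finite_imp_closed) auto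
    then have "\<forall>\<^sub>F w in at z. w \<in> - ((- \<Omega>) - {z})"
      by (intro eventually_at_in_open') auto
    moreover have "\<forall>\<^sub>F w in at z. w \<noteq> z" by (simp add: eventually_at_filter)
    ultimately have "\<forall>\<^sub>F w in at z. norm (\<phi> w) \<le> R * norm (1 :: complex)"
    proof eventually_elim
      case (elim w)
      have "norm w \<le> norm z + norm (z - w)" by (metis norm_triangle_sub norm_minus_commute)
      with elim show ?case by (auto simp: dist_norm intro!: R)
    qed
    then show ?thesis by (rule bigoI)
  qed
  then obtain g where g: "g holomorphic_on UNIV" "\<And>z. z \<in> \<Omega> \<Longrightarrow> g z = \<phi> z"
    using removable_singularities[OF P.finite_compl _ hol] by auto
  have gp: "g (p \<tau>) = p' \<tau>" if "\<tau> \<in> \<H>" for \<tau> using g(2)[OF P.in_range[OF that]] \<phi>[OF that] by simp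
  obtain F r where F: "r > 0" "F holomorphic_on ball 0 r" "F 0 = 0" "deriv F 0 \<noteq> 0"
    "\<And>\<tau>. norm (q_param N \<tau>) < r \<Longrightarrow> Im \<tau> > 1 \<and> p \<tau> \<noteq> 0 \<and> F (q_param N \<tau>) = 1 / p \<tau>"
    by (rule P.cusp_expansion) blast
  obtain F' r' where F': "r' > 0" "F' holomorphic_on ball 0 r'" "F' 0 = 0" "deriv F' 0 \<noteq> 0"
    "\<And>\<tau>. norm (q_param N \<tau>) < r' \<Longrightarrow> Im \<tau> > 1 \<and> p' \<tau> \<noteq> 0 \<and> F' (q_param N \<tau>) = 1 / p' \<tau>"
    by (rule P'.cusp_expansion) blast
  obtain C where "\<forall>\<^sub>F q in at 0. norm (F q) \<le> C * norm (F' q)"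
    by (rule simple_zeros_comparable[of F "min r r'" F'])
       (use F F' in \<open>auto intro: holomorphic_on_subset\<close>)
  moreover have "\<forall>\<^sub>F q in at 0. q \<in> ball 0 (min r r')"
    using F(1) F'(1) by (intro eventually_at_in_open') auto
  ultimately have "\<forall>\<^sub>F q in at 0. norm (F q) \<le> C * norm (F' q) \<and> norm q < r \<and> norm q < r'"
    by eventually_elim auto
  then have "\<forall>\<^sub>F \<tau> in Im_at_top. norm (F (q_param N \<tau>)) \<le> C * norm (F' (q_param N \<tau>)) \<and>
      norm (q_param N \<tau>) < r \<and> norm (q_param N \<tau>) < r'"
    using eventually_at_0_q_param[OF P.N_pos] by simp
  then obtain Y where Y: "\<And>\<tau>. Im \<tau> > Y \<Longrightarrow> norm (F (q_param N \<tau>)) \<le> C * norm (F' (q_param N \<tau>)) \<and>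
      norm (q_param N \<tau>) < r \<and> norm (q_param N \<tau>) < r'"
    unfolding eventually_Im_at_top by blast
  have growth: "norm (p' \<tau>) \<le> C * norm (p \<tau>)" if "Im \<tau> > Y" for \<tau>
  proof -
    have "p \<tau> \<noteq> 0" "p' \<tau> \<noteq> 0" "norm (1 / p \<tau>) \<le> C * norm (1 / p' \<tau>)"
      using Y[OF that] F(5)[of \<tau>] F'(5)[of \<tau>] by auto
    then show ?thesis by (simp add: norm_divide field_simps)
  qed
  obtain R where R: "R > 0" "\<And>w. norm w > R \<Longrightarrow> \<exists>\<tau>. Im \<tau> > max Y 0 \<and> p \<tau> = w"
    using P.large_values[of "max Y 0"] by blast
  have gw: "norm (g w) \<le> C * norm w ^ 1" if "R + 1 \<le> norm w" for w
  proof -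
    obtain \<tau> where \<tau>: "Im \<tau> > max Y 0" "p \<tau> = w" using R(2)[of w] \<open>R + 1 \<le> norm w\<close> by auto
    with growth[of \<tau>] gp[of \<tau>] show ?thesis by (simp add: in_upper_half_plane_iff)
  qed
  \<comment> \<open>Liouville's theorem with degree bound 1, for the sake of which \<open>gw\<close>
    carries the exponent 1.\<close>
  have lin: "g w = deriv g 0 * w + g 0" for w
    by (subst Liouville_polynomial[OF g(1) gw]) simp_all
  \<comment> \<open>Otherwise p' would be constantly g 0, whereas it takes all sufficiently large
    values; w below is large enough for that and larger than g 0 in norm.\<close>
  have "deriv g 0 \<noteq> 0"
  proof
    assume 0: "deriv g 0 = 0"
    obtain R where R: "R > 0" "\<And>w. norm w > R \<Longrightarrow> \<exists>\<tau>. Im \<tau> > 0 \<and> p' \<tau> = w"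
      using P'.large_values[of 0] by blast
    define w where "w = complex_of_real (R + norm (g 0) + 1)"
    have "norm w = R + norm (g 0) + 1" unfolding w_def norm_of_real using R(1) by simp
    then have w: "norm w > R" "norm w > norm (g 0)" using R(1) norm_ge_zero[of "g 0"] by linarith+
    then obtain \<tau> where "Im \<tau> > 0" "p' \<tau> = w" using R(2) by blast
    then have "w = g 0" using gp[of \<tau>] lin[of "p \<tau>"] 0 by (simp add: in_upper_half_plane_iff)
    with w show False by simp
  qed
  moreover have "p' \<tau> = deriv g 0 * p \<tau> + g 0" if "\<tau> \<in> \<H>" for \<tau>
    using lin[of "p \<tau>"] gp[OF that] by simp
  ultimately show thesis by (rule that)
qed

section \<open>Power series at the cusp and the coefficient polynomials\<close>

lemma has_fps_expansion_if_sums: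
  fixes F :: "complex \<Rightarrow> complex"
  assumes "\<rho> > 0" "\<And>q. norm q < \<rho> \<Longrightarrow> (\<lambda>k. fps_nth X k * q ^ k) sums F q"
  shows "F has_fps_expansion X"
proof -
  \<comment> \<open>Convergence at this one nonzero point already gives a positive radius of
    convergence.\<close>
  define q where "q = complex_of_real (\<rho> / 2)"
  have q: "norm q < \<rho>" "norm q > 0" using assms(1) by (auto simp: q_def)
  have "summable (\<lambda>k. fps_nth X k * q ^ k)" using assms(2)[OF q(1)] by (rule sums_summable)
  then have "fps_conv_radius X \<ge> ereal (norm q)"
    unfolding fps_conv_radius_def by (rule conv_radius_geI)
  moreover have "0 < ereal (norm q)" using q(2) by simp
  ultimately have "fps_conv_radius X > 0" by (rule order.strict_trans2[rotated])
  moreover have "\<forall>\<^sub>F z in nhds 0. z \<in> ball (0::complex) \<rho>"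
    using assms(1) by (intro eventually_nhds_in_open) auto
  then have "\<forall>\<^sub>F z in nhds 0. eval_fps X z = F z"
    by eventually_elim (use assms(2) in \<open>auto simp: eval_fps_def sums_iff\<close>)
  ultimately show ?thesis by (simp add: has_fps_expansion_def)
qed

context cusp_covering
begin

text \<open>The last clause reaches beyond a small disc: on any half plane Im > y, y >= 0, where p
  has no zero, 1 / p descends to a holomorphic function on the whole corresponding disc. It has the
  same germ at 0, so the same Taylor series converges to it throughout.\<close>

lemma fps_at_cusp:
  obtains X F r where "r > 0" "F holomorphic_on ball 0 r" "F has_fps_expansion X" "F 0 = 0"
    "fps_nth X 0 = 0" "fps_nth X 1 \<noteq> 0"
    "\<And>\<tau>. norm (q_param N \<tau>) < r \<Longrightarrow> Im \<tau> > 1 \<and> p \<tau> \<noteq> 0 \<and> F (q_param N \<tau>) = 1 / p \<tau>"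
    "\<And>y \<tau>. y \<ge> 0 \<Longrightarrow> (\<And>\<tau>. Im \<tau> > y \<Longrightarrow> p \<tau> \<noteq> 0) \<Longrightarrow> Im \<tau> > y \<Longrightarrow>
       (\<lambda>k. fps_nth X k * q_param N \<tau> ^ k) sums (1 / p \<tau>)"
proof -
  obtain F r where F: "r > 0" "F holomorphic_on ball 0 r" "F 0 = 0" "deriv F 0 \<noteq> 0"
    "\<And>\<tau>. norm (q_param N \<tau>) < r \<Longrightarrow> Im \<tau> > 1 \<and> p \<tau> \<noteq> 0 \<and> F (q_param N \<tau>) = 1 / p \<tau>"
    by (rule cusp_expansion) blast
  define X where "X = fps_expansion F 0"
  have "F analytic_on {0}"
    using F(1,2) analytic_at by (metis centre_in_ball open_ball)
  then have FX: "F has_fps_expansion X"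
    unfolding X_def by (rule analytic_at_imp_has_fps_expansion_0)
  have X0: "fps_nth X 0 = 0" "fps_nth X 1 \<noteq> 0"
    using F(3,4) by (simp_all add: X_def fps_expansion_def)
  have "(\<lambda>k. fps_nth X k * q_param N \<tau> ^ k) sums (1 / p \<tau>)"
    if y: "y \<ge> 0" "\<And>\<tau>. Im \<tau> > y \<Longrightarrow> p \<tau> \<noteq> 0" and \<tau>: "Im \<tau> > y" for y \<tau>
  proof -
    define s where "s = exp (- (2 * pi / N * y))"
    have s: "norm (q_param N \<sigma>) < s \<longleftrightarrow> Im \<sigma> > y" for \<sigma>
      unfolding s_def by (rule norm_q_param_less_iff[OF N_pos])
    have "(\<lambda>\<tau>. 1 / p \<tau>) holomorphic_on {\<tau>. Im \<tau> > y}"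
      by (intro holomorphic_intros holomorphic_on_subset[OF holo])
         (use y in \<open>force simp: in_upper_half_plane_iff\<close>)+
    moreover have "1 / p \<tau> = 1 / p \<tau>'" if "Im \<tau> > y" "q_param N \<tau> = q_param N \<tau>'" for \<tau> \<tau>'
      using q_invariant[OF _ that(2)] that(1) y(1) by (simp add: in_upper_half_plane_iff)
    ultimately obtain G where G: "G holomorphic_on ball 0 s - {0}"
      "\<And>\<tau>. Im \<tau> > y \<Longrightarrow> G (q_param N \<tau>) = 1 / p \<tau>"
      using descend_q_param[OF N_pos, of "\<lambda>\<tau>. 1 / p \<tau>" y] unfolding s_def by metis
    define E where "E = (\<lambda>q. if q = 0 then 0 else G q)"
    have FG: "F q = G q" if "q \<noteq> 0" "norm q < r" "norm q < s" for q
    proof -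
      obtain \<sigma> where "q_param N \<sigma> = q" using q_param_surj[OF N_pos \<open>q \<noteq> 0\<close>] by blast
      with F(5)[of \<sigma>] G(2)[of \<sigma>] s[of \<sigma>] that show ?thesis by simp
    qed
    have sp: "s > 0" by (simp add: s_def)
    have ev: "\<forall>\<^sub>F q in nhds 0. q \<in> ball 0 (min r s)"
      using F(1) sp by (intro eventually_nhds_in_open) auto
    have "isCont F 0"
      using F(1,2) by (metis centre_in_ball continuous_on_interior holomorphic_on_imp_continuous_on interior_ball)
    then have "(F \<longlongrightarrow> 0) (at 0)" using F(3) by (simp add: isCont_def)
    moreover have "\<forall>\<^sub>F q in at 0. F q = G q"
      using ev unfolding eventually_at_filter by eventually_elim (use FG in auto)
    ultimately have "(G \<longlongrightarrow> 0) (at 0)" by (rule Lim_transform_eventually)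
    then have "E holomorphic_on ball 0 s" unfolding E_def
      by (rule removable_singularity[OF G(1) open_ball])
    moreover have "E has_fps_expansion X"
    proof (subst has_fps_expansion_cong[of _ F _ X])
      show "\<forall>\<^sub>F q in nhds 0. E q = F q"
        using ev by eventually_elim (use FG F(3) in \<open>auto simp: E_def\<close>)
    qed (use FX in auto)
    ultimately have "(\<lambda>k. fps_nth X k * q_param N \<tau> ^ k) sums E (q_param N \<tau>)"
      using s[of \<tau>] \<tau> by (intro has_fps_expansion_imp_sums_complex[of E X "ereal s"]) auto
    then show ?thesis using G(2)[OF \<tau>] by (simp add: E_def)
  qed
  with F FX X0 show thesis by (intro that[of r F X]) auto
qed

end

text \<open>The polynomials: solving x (1 + b e) = e by a geometric series, where the quadratic
  coefficient t of x determines b = e 2 - t.\<close>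

definition coefficient_poly :: "complex fps \<Rightarrow> nat \<Rightarrow> complex poly" where
  "coefficient_poly e m = (\<Sum>k<m. smult (fps_nth (e ^ Suc k) m) ([:- fps_nth e 2, 1:] ^ k))"

lemma coefficient_poly:
  assumes eq: "x * (1 + fps_const b * e) = e" and e: "fps_nth e 0 = 0" "fps_nth e 1 = 1"
  shows "fps_nth x m = poly (coefficient_poly e m) (fps_nth x 2)"
proof -
  have x: "x = e + fps_const (- b) * (e * x)"
    using eq by (simp add: algebra_simps flip: fps_const_neg)
  have x0: "fps_nth x 0 = 0" using arg_cong[OF x, of "\<lambda>y. fps_nth y 0"] e by simp
  have x1: "fps_nth x 1 = 1" using arg_cong[OF x, of "\<lambda>y. fps_nth y 1"] e x0
    by (simp add: fps_mult_nth_1)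
  \<comment> \<open>Only the two linear coefficients contribute. This is what expresses b by the
    quadratic coefficients of x and e.\<close>
  have "fps_nth (e * x) 2 = 1"
    using e x0 x1 by (simp add: fps_mult_nth numeral_2_eq_2 atLeast0_atMost_Suc)
  then have b: "- b = fps_nth x 2 - fps_nth e 2" using arg_cong[OF x, of "\<lambda>y. fps_nth y 2"] by simp
  \<comment> \<open>The finite geometric series with its remainder, from repeated substitution of x
    = e - b e x into itself.\<close>
  have geo: "x = (\<Sum>k<j. fps_const ((- b) ^ k) * e ^ Suc k) + fps_const ((- b) ^ j) * (e ^ j * x)" for j
  proof (induction j)
    case (Suc j)
    have "fps_const ((- b) ^ j) * (e ^ j * x) =
          fps_const ((- b) ^ j) * e ^ Suc j + fps_const ((- b) ^ Suc j) * (e ^ Suc j * x)"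
      by (subst (1) x) (simp add: algebra_simps flip: fps_const_mult)
    with Suc.IH show ?case by (simp add: add.assoc del: power_Suc)
  qed simp
  \<comment> \<open>Both e and x start in degree 1, so the remainder after m terms starts in degree
    m + 1 and misses the coefficient m.\<close>
  have "fps_nth (e ^ m * x) m = 0"
  proof -
    have "fps_nth (e ^ m) i * fps_nth x (m - i) = 0" if "i \<le> m" for i
      using that x0 startsby_zero_power_prefix[OF e(1), of m] by (cases "i = m") auto
    then show ?thesis unfolding fps_mult_nth by (intro sum.neutral) auto
  qed
  then have "fps_nth x m = (\<Sum>k<m. (- b) ^ k * fps_nth (e ^ Suc k) m)"
    by (subst geo[of m]) (simp add: fps_sum_nth del: power_Suc)
  also have "\<dots> = poly (coefficient_poly e m) (fps_nth x 2)"
    unfolding coefficient_poly_def b by (simp add: poly_sum mult.commute del: power_Suc)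
  finally show ?thesis .
qed

text \<open>Linear coefficients give A \<alpha> = h; dividing X by A and H by h then leads to
  \<open>coefficient_poly\<close> with b = A \<beta>. As e involves neither \<alpha> nor \<beta>,
  one family of polynomials serves all affine images of the reference function.\<close>

lemma coefficient_poly_moebius:
  assumes eq: "X * (fps_const \<alpha> + fps_const \<beta> * H) = H" and H: "fps_nth H 0 = 0" "fps_nth H 1 \<noteq> 0" and \<alpha>: "\<alpha> \<noteq> 0"
  defines "e \<equiv> fps_const (1 / fps_nth H 1) * H"
  shows "fps_nth X m = fps_nth X 1 * poly (coefficient_poly e m) (fps_nth X 2 / fps_nth X 1)"
proof -
  define h where "h = fps_nth H 1"
  define A where "A = fps_nth X 1"
  have X0: "fps_nth X 0 = 0" using arg_cong[OF eq, of "\<lambda>y. fps_nth y 0"] H(1) \<alpha> by simp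
  have A\<alpha>: "A * \<alpha> = h"
    using arg_cong[OF eq, of "\<lambda>y. fps_nth y 1"] H(1) X0 by (simp add: fps_mult_nth_1 A_def h_def)
  then have nz: "A \<noteq> 0" "h \<noteq> 0" using H(2) by (auto simp: h_def)
  define x where "x = fps_const (1 / A) * X"
  have "x * (1 + fps_const (A * \<beta>) * e) = fps_const (1 / h) * (X * (fps_const \<alpha> + fps_const \<beta> * H))"
  proof -
    have "fps_const (1 / h) * (X * (fps_const \<alpha> + fps_const \<beta> * H)) =
      X * (fps_const (\<alpha> / h) + fps_const (\<beta> / h) * H)"
      by (simp add: ring_distribs flip: fps_const_mult mult.assoc)
         (simp add: mult.assoc mult.commute mult.left_commute flip: mult.assoc)
    also have "\<alpha> / h = 1 / A" using A\<alpha> nz by (auto simp: field_simps)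
    also have "X * (fps_const (1 / A) + fps_const (\<beta> / h) * H) = x * (1 + fps_const (A * \<beta>) * e)"
      unfolding x_def e_def h_def[symmetric] using nz
      by (simp add: ring_distribs)
    finally show ?thesis by simp
  qed
  also have "\<dots> = e" unfolding eq e_def h_def ..
  finally have "x * (1 + fps_const (A * \<beta>) * e) = e" .
  from coefficient_poly[OF this, of m]
  have "fps_nth x m = poly (coefficient_poly e m) (fps_nth x 2)"
    using H nz by (simp add: e_def h_def)
  then show ?thesis using nz by (simp add: x_def A_def[symmetric] field_simps del: One_nat_def)
qed

section \<open>Coverings of the same punctured sphere\<close>

lemma filterlim_Im_at_topI:
  assumes "\<And>Y. \<exists>y. \<forall>\<tau>. Im \<tau> > y \<longrightarrow> Im (\<Phi> \<tau>) > Y"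
  shows "filterlim \<Phi> Im_at_top Im_at_top"
  unfolding filterlim_iff eventually_Im_at_top using assms by meson

lemma tendsto_q_param: "N > 0 \<Longrightarrow> (q_param N \<longlongrightarrow> 0) Im_at_top"
  using filterlim_q_param_iff[of N "\<lambda>q. q" "nhds 0"] by simp

lemma q_param_eq_imp_Im_eq:
  assumes "N > 0" "q_param N \<tau> = q_param N \<tau>'"
  shows "Im \<tau> = Im \<tau>'"
  using assms q_param_eq_iff[OF assms(1), of \<tau> \<tau>'] by auto

text \<open>Near infinity, Im (\<Phi> \<tau>) avoids the value 1, since an orbit meeting the horoball Im > 1 misses
  the horocycle Im = 1; by connectedness \<Phi> then stays in the horoball.\<close>

lemma cusp_covering_lift:
  assumes "cusp_covering N \<Omega> p" "cusp_covering N \<Omega> p'"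
  obtains \<Phi> \<Psi> where "\<Phi> ` \<H> \<subseteq> \<H>" "\<And>\<tau>. \<tau> \<in> \<H> \<Longrightarrow> p (\<Phi> \<tau>) = p' \<tau>"
    "\<Psi> holomorphic_on ball 0 1" "\<Psi> 0 = 0" "\<And>q. norm q < 1 \<Longrightarrow> norm (\<Psi> q) < 1"
    "\<And>\<tau>. \<tau> \<in> \<H> \<Longrightarrow> \<Psi> (q_param N \<tau>) = q_param N (\<Phi> \<tau>)"
proof -
  interpret P: cusp_covering N \<Omega> p by fact
  interpret P': cusp_covering N \<Omega> p' by fact
  \<comment> \<open>High up p' is large, and p takes large values at any prescribed height, so p'
    \<tau> has a preimage under p in a given horoball.\<close>
  have large: "\<exists>y>1. \<forall>\<tau>. Im \<tau> > y \<longrightarrow> (\<exists>w. Im w > Y \<and> p w = p' \<tau>)" for Y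
  proof -
    obtain R where R: "R > 0" "\<And>w. norm w > R \<Longrightarrow> \<exists>\<tau>. Im \<tau> > Y \<and> p \<tau> = w"
      using P.large_values[of Y] by blast
    have "\<forall>\<^sub>F \<tau> in Im_at_top. R + 1 \<le> norm (p' \<tau>)"
      using P'.at_cusp R(1) unfolding filterlim_at_infinity[OF order.refl] by simp
    then obtain y where y: "\<And>\<tau>. Im \<tau> > y \<Longrightarrow> R + 1 \<le> norm (p' \<tau>)"
      unfolding eventually_Im_at_top by blast
    have "\<exists>w. Im w > Y \<and> p w = p' \<tau>" if "Im \<tau> > max y 2" for \<tau>
      using y[of \<tau>] that R(2)[of "p' \<tau>"] by auto
    then show ?thesis by (intro exI[of _ "max y 2"]) auto
  qed
  obtain y1 where y1: "y1 > 1" "\<And>\<tau>. Im \<tau> > y1 \<Longrightarrow> \<exists>w. Im w > 1 \<and> p w = p' \<tau>"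
    using large[of 1] by blast
  \<comment> \<open>The lift is normalised at this point: its value w0 lies in the horoball Im > 1,
    and this is what makes it fix the cusp.\<close>
  define \<tau>0 where "\<tau>0 = Complex 0 (y1 + 1)"
  have \<tau>0: "Im \<tau>0 > y1" "\<tau>0 \<in> \<H>" using y1(1) by (auto simp: \<tau>0_def in_upper_half_plane_iff)
  obtain w0 where w0: "Im w0 > 1" "p w0 = p' \<tau>0" using y1(2)[OF \<tau>0(1)] by blast
  then have "w0 \<in> \<H>" by (simp add: in_upper_half_plane_iff)
  have "p' ` \<H> \<subseteq> \<Omega>" using P'.in_range by blast
  then obtain \<Phi> where \<Phi>: "\<Phi> holomorphic_on \<H>" "\<Phi> ` \<H> \<subseteq> \<H>" "\<Phi> \<tau>0 = w0"
    "\<And>\<tau>. \<tau> \<in> \<H> \<Longrightarrow> p (\<Phi> \<tau>) = p' \<tau>"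
    using holomorphic_lift[OF open_upper_half_plane _ P.holo P.cov open_upper_half_plane
      simply_connected_upper_half_plane P'.holo _ \<tau>0(2) \<open>w0 \<in> \<H>\<close> w0(2)[symmetric]] \<tau>0(2) by blast
  have \<Phi>H: "Im (\<Phi> \<tau>) > 0" if "Im \<tau> > 0" for \<tau>
    using image_subset_iff[THEN iffD1, OF \<Phi>(2)] that by (simp add: in_upper_half_plane_iff)
  let ?D = "{\<tau>. Im \<tau> > y1}"
  have DH: "?D \<subseteq> \<H>" using y1(1) by (auto simp: in_upper_half_plane_iff)
  have ne1: "Im (\<Phi> \<tau>) \<noteq> 1" if \<tau>: "\<tau> \<in> ?D" for \<tau>
  proof
    assume *: "Im (\<Phi> \<tau>) = 1"
    obtain w where w: "Im w > 1" "p w = p' \<tau>" using y1(2)[of \<tau>] \<tau> by auto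
    have "p w = p (\<Phi> \<tau>)" using w(2) \<Phi>(4) that DH by (metis subsetD)
    then have "q_param N w = q_param N (\<Phi> \<tau>)" using P.horoball_fibre[of w "\<Phi> \<tau>"] w(1) * by simp
    then have "Im w = Im (\<Phi> \<tau>)" by (rule q_param_eq_imp_Im_eq[OF P.N_pos])
    then show False using w(1) * by simp
  qed
  have cont: "continuous_on ?D (\<lambda>\<tau>. Im (\<Phi> \<tau>))"
    by (intro continuous_intros holomorphic_on_imp_continuous_on holomorphic_on_subset[OF \<Phi>(1) DH])
  have "connected ?D" by (rule convex_connected[OF convex_halfspace_Im_gt])
  have D1: "Im (\<Phi> \<tau>) > 1" if "\<tau> \<in> ?D" for \<tau>
  proof (rule ccontr)
    assume "\<not> Im (\<Phi> \<tau>) > 1"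
    have "connected ((\<lambda>\<tau>. Im (\<Phi> \<tau>)) ` ?D)"
      using cont \<open>connected ?D\<close> by (rule connected_continuous_image)
    moreover have "Im (\<Phi> \<tau>) \<in> (\<lambda>\<tau>. Im (\<Phi> \<tau>)) ` ?D" "Im (\<Phi> \<tau>0) \<in> (\<lambda>\<tau>. Im (\<Phi> \<tau>)) ` ?D"
      using that \<tau>0 by blast+
    moreover have "Im (\<Phi> \<tau>) \<le> 1" "1 \<le> Im (\<Phi> \<tau>0)" using \<open>\<not> Im (\<Phi> \<tau>) > 1\<close> \<Phi>(3) w0(1) by auto
    ultimately have "1 \<in> (\<lambda>\<tau>. Im (\<Phi> \<tau>)) ` ?D" by (rule connectedD_interval)
    then show False using ne1 by auto
  qed
  have "filterlim \<Phi> Im_at_top Im_at_top"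
  proof (rule filterlim_Im_at_topI)
    fix Y
    \<comment> \<open>The point w above Y and the point \<Phi> \<tau> lie in one fibre of p and in
      the horoball, so they have the same height.\<close>
    obtain y where y: "y > 1" "\<And>\<tau>. Im \<tau> > y \<Longrightarrow> \<exists>w. Im w > max Y 1 \<and> p w = p' \<tau>"
      using large[of "max Y 1"] by blast
    have "Im (\<Phi> \<tau>) > Y" if \<tau>: "Im \<tau> > max y y1" for \<tau>
    proof -
      obtain w where w: "Im w > max Y 1" "p w = p' \<tau>" using y(2)[of \<tau>] \<tau> by auto
      have "\<tau> \<in> \<H>" using \<tau> y(1) by (simp add: in_upper_half_plane_iff)
      then have "p w = p (\<Phi> \<tau>)" using w(2) \<Phi>(4) by simp
      moreover have "Im (\<Phi> \<tau>) > 1" using D1 \<tau> by simp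
      ultimately have "q_param N w = q_param N (\<Phi> \<tau>)"
        using P.horoball_fibre[of w "\<Phi> \<tau>"] w(1) by simp
      then have "Im w = Im (\<Phi> \<tau>)" by (rule q_param_eq_imp_Im_eq[OF P.N_pos])
      with w(1) show ?thesis by simp
    qed
    then show "\<exists>y. \<forall>\<tau>. Im \<tau> > y \<longrightarrow> Im (\<Phi> \<tau>) > Y" by blast
  qed
  from filterlim_compose[OF tendsto_q_param[OF P.N_pos] this]
  have lim: "((\<lambda>\<tau>. q_param N (\<Phi> \<tau>)) \<longlongrightarrow> 0) Im_at_top" .
  \<comment> \<open>High up, both images lie in the horoball and \<open>horoball_fibre\<close>
    applies. Further down \<Phi> may leave it, and the identity theorem carries the relation
    over.\<close>
  have per: "q_param N (\<Phi> \<tau>) = q_param N (\<Phi> \<tau>')"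
    if \<tau>: "Im \<tau> > 0" and eq: "q_param N \<tau> = q_param N \<tau>'" for \<tau> \<tau>'
  proof -
    obtain k :: int where k: "\<tau>' = \<tau> + of_nat N * of_int k"
      using eq q_param_eq_iff[OF P.N_pos] by blast
    have sub: "(\<lambda>\<tau>. \<tau> + of_nat N * of_int k) ` \<H> \<subseteq> \<H>" by (auto simp: in_upper_half_plane_iff)
    have "q_param N (\<Phi> \<tau>) = q_param N (\<Phi> (\<tau> + of_nat N * of_int k))"
    proof (rule analytic_continuation_open[where s = ?D and s' = \<H> and z = \<tau> and f = "\<lambda>\<tau>. q_param N (\<Phi> \<tau>)"
          and g = "\<lambda>\<tau>. q_param N (\<Phi> (\<tau> + of_nat N * of_int k))"])
      show "open ?D" by (rule open_halfspace_Im_gt)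
      show "connected \<H>" by (rule convex_connected[OF convex_upper_half_plane])
      show "(\<lambda>\<tau>. q_param N (\<Phi> \<tau>)) holomorphic_on \<H>"
        using holomorphic_on_compose[OF \<Phi>(1) holomorphic_q_param] by (simp add: o_def)
      have "(\<lambda>\<tau>. \<tau> + of_nat N * of_int k) holomorphic_on \<H>" by (intro holomorphic_intros)
      from holomorphic_on_compose_gen[OF this \<Phi>(1) sub]
      have "(\<lambda>\<tau>. \<Phi> (\<tau> + of_nat N * of_int k)) holomorphic_on \<H>" by (simp add: o_def)
      from holomorphic_on_compose[OF this holomorphic_q_param]
      show "(\<lambda>\<tau>. q_param N (\<Phi> (\<tau> + of_nat N * of_int k))) holomorphic_on \<H>" by (simp add: o_def)
      show "q_param N (\<Phi> z) = q_param N (\<Phi> (z + of_nat N * of_int k))" if z: "z \<in> ?D" for z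
      proof (rule P.horoball_fibre)
        have zH: "z \<in> \<H>" "z + of_nat N * of_int k \<in> \<H>" using z DH by (auto simp: in_upper_half_plane_iff)
        show "Im (\<Phi> z) > 1" using D1 z by simp
        have "z + of_nat N * of_int k \<in> ?D" using z by simp
        from D1[OF this] show "Im (\<Phi> (z + of_nat N * of_int k)) \<ge> 1" by simp
        show "p (\<Phi> z) = p (\<Phi> (z + of_nat N * of_int k))"
          using \<Phi>(4)[OF zH(1)] \<Phi>(4)[OF zH(2)] P'.translation_invariant[OF zH(1)] by simp
      qed
      show "?D \<noteq> {}" using \<tau>0(1) by blast
    qed (use DH \<tau> open_upper_half_plane in \<open>auto simp: in_upper_half_plane_iff\<close>)
    then show ?thesis using k by simp
  qed
  have "(\<lambda>\<tau>. q_param N (\<Phi> \<tau>)) holomorphic_on {\<tau>. Im \<tau> > 0}"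
    using holomorphic_on_compose[OF \<Phi>(1) holomorphic_q_param] by (simp add: o_def upper_half_plane_def)
  from descend_q_param[OF P.N_pos this per]
  obtain G where "G holomorphic_on ball 0 (exp (- (2 * pi / N * 0))) - {0}"
    and G2: "\<And>\<tau>. Im \<tau> > 0 \<Longrightarrow> G (q_param N \<tau>) = q_param N (\<Phi> \<tau>)" by blast
  then have G: "G holomorphic_on ball 0 1 - {0}" by simp
  have q1: "norm (q_param N \<tau>) < 1 \<longleftrightarrow> Im \<tau> > 0" for \<tau>
    using norm_q_param_less_iff[OF P.N_pos, of \<tau> 0] by simp
  have "\<forall>\<^sub>F \<tau> in Im_at_top. q_param N (\<Phi> \<tau>) = G (q_param N \<tau>)"
    using eventually_Im_at_top_gt[of 0] by eventually_elim (use G2 in simp)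
  with lim have "((\<lambda>\<tau>. G (q_param N \<tau>)) \<longlongrightarrow> 0) Im_at_top" by (rule Lim_transform_eventually)
  then have limG: "(G \<longlongrightarrow> 0) (at 0)" by (simp add: filterlim_q_param_iff[OF P.N_pos])
  define \<Psi> where "\<Psi> = (\<lambda>q. if q = 0 then 0 else G q)"
  show thesis
  proof (rule that[of \<Phi> \<Psi>])
    show "\<Psi> holomorphic_on ball 0 1" unfolding \<Psi>_def
      by (rule removable_singularity[OF G open_ball limG])
    show "norm (\<Psi> q) < 1" if "norm q < 1" for q
    proof (cases "q = 0")
      case False
      then obtain \<tau> where \<tau>: "q_param N \<tau> = q" using q_param_surj[OF P.N_pos] by blast
      then have "Im \<tau> > 0" using that q1 by blast
      then have "norm (q_param N (\<Phi> \<tau>)) < 1" using q1 \<Phi>H by blast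
      with G2[OF \<open>Im \<tau> > 0\<close>] \<tau> False show ?thesis by (simp add: \<Psi>_def)
    qed (simp add: \<Psi>_def)
  qed (use \<Phi>(2,4) G2 in \<open>auto simp: \<Psi>_def in_upper_half_plane_iff\<close>)
qed

text \<open>In the coordinate q the relation between p o \<Phi> and p' reads F o \<Psi> = F' near 0;
  the chain rule is applied at the fixed point 0 of \<Psi>.\<close>

lemma cusp_covering_lift_deriv:
  assumes "cusp_covering N \<Omega> p" "r > 0" "F holomorphic_on ball 0 r" "F 0 = 0"
    and F: "\<And>\<tau>. norm (q_param N \<tau>) < r \<Longrightarrow> Im \<tau> > 1 \<and> p \<tau> \<noteq> 0 \<and> F (q_param N \<tau>) = 1 / p \<tau>"
    and "cusp_covering N \<Omega> p'" "r' > 0" "F' holomorphic_on ball 0 r'" "F' 0 = 0"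
    and F': "\<And>\<tau>. norm (q_param N \<tau>) < r' \<Longrightarrow> Im \<tau> > 1 \<and> p' \<tau> \<noteq> 0 \<and> F' (q_param N \<tau>) = 1 / p' \<tau>"
    and "\<Phi> ` \<H> \<subseteq> \<H>" and \<Phi>: "\<And>\<tau>. \<tau> \<in> \<H> \<Longrightarrow> p (\<Phi> \<tau>) = p' \<tau>"
    and \<Psi>: "\<Psi> holomorphic_on ball 0 1" "\<Psi> 0 = 0" "\<And>\<tau>. \<tau> \<in> \<H> \<Longrightarrow> \<Psi> (q_param N \<tau>) = q_param N (\<Phi> \<tau>)"
  shows "deriv F' 0 = deriv F 0 * deriv \<Psi> 0"
proof -
  have N: "N > 0" using assms(1) by (rule cusp_covering.N_pos)
  have \<Psi>': "(\<Psi> has_field_derivative deriv \<Psi> 0) (at 0)"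
    using \<Psi>(1) by (rule holomorphic_derivI) auto
  have "(F has_field_derivative deriv F 0) (at (\<Psi> 0))"
    unfolding \<Psi>(2) using assms(3) by (rule holomorphic_derivI) (use assms(2) in auto)
  from DERIV_chain[OF this \<Psi>'] have chain: "(F \<circ> \<Psi> has_field_derivative deriv F 0 * deriv \<Psi> 0) (at 0)" .
  have "(\<Psi> \<longlongrightarrow> 0) (at 0)" using DERIV_isCont[OF \<Psi>'] \<Psi>(2) by (simp add: isCont_def)
  then have "\<forall>\<^sub>F q in at 0. norm (\<Psi> q) < r"
    using order_tendstoD(2)[OF tendsto_norm_zero] assms(2) by blast
  then have "\<forall>\<^sub>F q in nhds 0. q \<noteq> 0 \<longrightarrow> norm (\<Psi> q) < r" by (simp add: eventually_at_filter)
  moreover have "\<forall>\<^sub>F q in nhds 0. q \<in> ball 0 r'"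
    using assms by (intro eventually_nhds_in_open) auto
  ultimately have "\<forall>\<^sub>F q in nhds 0. (F \<circ> \<Psi>) q = F' q"
  proof eventually_elim
    case (elim q)
    show ?case
    proof (cases "q = 0")
      case False
      then obtain \<tau> where \<tau>: "q_param N \<tau> = q" using q_param_surj[OF N] by blast
      then have \<tau>': "Im \<tau> > 1" "F' q = 1 / p' \<tau>" using F'[of \<tau>] elim by auto
      then have "\<tau> \<in> \<H>" by (simp add: in_upper_half_plane_iff)
      with \<Psi>(3) \<tau> have "\<Psi> q = q_param N (\<Phi> \<tau>)" by blast
      with elim False F[of "\<Phi> \<tau>"] \<Phi>[OF \<open>\<tau> \<in> \<H>\<close>] \<tau>'(2) show ?thesis by simp
    qed (use \<Psi>(2) assms in auto)
  qed
  then have "deriv (F \<circ> \<Psi>) 0 = deriv F' 0" by (intro deriv_cong_ev refl)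
  then show ?thesis using DERIV_imp_deriv[OF chain] by simp
qed

text \<open>The two lifts need not be known to be mutually inverse. The two chain rules already make
  the product of their derivatives at 0 equal to 1, and as neither exceeds 1 in norm, both have norm
  1: the equality case of the Schwarz lemma.\<close>

lemma cusp_coverings_shift:
  assumes "cusp_covering N \<Omega> p" "cusp_covering N \<Omega> p'"
  obtains k :: real where "\<And>\<tau>. \<tau> \<in> \<H> \<Longrightarrow> p' \<tau> = p (\<tau> + of_real k)"
proof -
  interpret P: cusp_covering N \<Omega> p by fact
  interpret P': cusp_covering N \<Omega> p' by fact
  obtain F r where F: "r > 0" "F holomorphic_on ball 0 r" "F 0 = 0" "deriv F 0 \<noteq> 0"
    "\<And>\<tau>. norm (q_param N \<tau>) < r \<Longrightarrow> Im \<tau> > 1 \<and> p \<tau> \<noteq> 0 \<and> F (q_param N \<tau>) = 1 / p \<tau>"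
    by (rule P.cusp_expansion) blast
  obtain F' r' where F': "r' > 0" "F' holomorphic_on ball 0 r'" "F' 0 = 0" "deriv F' 0 \<noteq> 0"
    "\<And>\<tau>. norm (q_param N \<tau>) < r' \<Longrightarrow> Im \<tau> > 1 \<and> p' \<tau> \<noteq> 0 \<and> F' (q_param N \<tau>) = 1 / p' \<tau>"
    by (rule P'.cusp_expansion) blast
  obtain \<Phi> \<Psi> where \<Phi>: "\<Phi> ` \<H> \<subseteq> \<H>" "\<And>\<tau>. \<tau> \<in> \<H> \<Longrightarrow> p (\<Phi> \<tau>) = p' \<tau>"
    "\<Psi> holomorphic_on ball 0 1" "\<Psi> 0 = 0" "\<And>q. norm q < 1 \<Longrightarrow> norm (\<Psi> q) < 1"
    "\<And>\<tau>. \<tau> \<in> \<H> \<Longrightarrow> \<Psi> (q_param N \<tau>) = q_param N (\<Phi> \<tau>)"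
    using cusp_covering_lift[OF assms] by blast
  obtain \<Phi>' \<Psi>' where \<Phi>': "\<Phi>' ` \<H> \<subseteq> \<H>" "\<And>\<tau>. \<tau> \<in> \<H> \<Longrightarrow> p' (\<Phi>' \<tau>) = p \<tau>"
    "\<Psi>' holomorphic_on ball 0 1" "\<Psi>' 0 = 0" "\<And>q. norm q < 1 \<Longrightarrow> norm (\<Psi>' q) < 1"
    "\<And>\<tau>. \<tau> \<in> \<H> \<Longrightarrow> \<Psi>' (q_param N \<tau>) = q_param N (\<Phi>' \<tau>)"
    using cusp_covering_lift[OF assms(2,1)] by blast
  have "deriv F' 0 = deriv F 0 * deriv \<Psi> 0"
    by (rule cusp_covering_lift_deriv[OF assms(1) F(1-3,5) assms(2) F'(1-3,5) \<Phi>(1,2,3,4,6)])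
  moreover have "deriv F 0 = deriv F' 0 * deriv \<Psi>' 0"
    by (rule cusp_covering_lift_deriv[OF assms(2) F'(1-3,5) assms(1) F(1-3,5) \<Phi>'(1,2,3,4,6)])
  ultimately have "deriv F 0 * 1 = deriv F 0 * (deriv \<Psi> 0 * deriv \<Psi>' 0)"
    by (metis mult.assoc mult.right_neutral)
  then have "deriv \<Psi> 0 * deriv \<Psi>' 0 = 1" using F(4) by (metis mult_cancel_left)
  then have prod: "norm (deriv \<Psi> 0) * norm (deriv \<Psi>' 0) = 1" by (metis norm_mult norm_one)
  have le: "norm (deriv \<Psi> 0) \<le> 1" "norm (deriv \<Psi>' 0) \<le> 1"
    using Schwarz_Lemma'[OF \<Phi>(3,4,5)] Schwarz_Lemma'[OF \<Phi>'(3,4,5)] by blast+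
  have "norm (deriv \<Psi> 0) * norm (deriv \<Psi>' 0) \<le> norm (deriv \<Psi> 0) * 1"
    by (rule mult_left_mono) (use le in auto)
  with prod le have "norm (deriv \<Psi> 0) = 1" by linarith
  then obtain \<alpha> where \<alpha>: "\<And>z. norm z < 1 \<Longrightarrow> \<Psi> z = \<alpha> * z" "norm \<alpha> = 1"
    using Schwarz_Lemma'[OF \<Phi>(3,4,5)] by blast
  then have "\<alpha> \<noteq> 0" by auto
  \<comment> \<open>Rotation of the disc by \<alpha> is translation by \<kappa> upstairs, and
    |\<alpha>| = 1 makes \<kappa> real.\<close>
  then obtain \<kappa> where \<kappa>: "q_param N \<kappa> = \<alpha>" by (rule q_param_surj[OF P.N_pos])
  have "Im \<kappa> = 0" using norm_q_param[of N \<kappa>] \<kappa> \<alpha>(2) P.N_pos by simp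
  then have \<kappa>r: "\<kappa> = of_real (Re \<kappa>)" by (simp add: complex_eq_iff)
  have "p' \<tau> = p (\<tau> + of_real (Re \<kappa>))" if \<tau>: "\<tau> \<in> \<H>" for \<tau>
  proof -
    have "norm (q_param N \<tau>) < 1"
      using norm_q_param_less_iff[OF P.N_pos, of \<tau> 0] \<tau> by (simp add: in_upper_half_plane_iff)
    then have "q_param N (\<Phi> \<tau>) = q_param N (\<tau> + \<kappa>)"
      using \<Phi>(6)[OF \<tau>] \<alpha>(1) \<kappa> by (simp add: q_param_add mult.commute)
    moreover have "\<Phi> \<tau> \<in> \<H>" using \<Phi>(1) \<tau> by blast
    ultimately have "p (\<Phi> \<tau>) = p (\<tau> + \<kappa>)" by (intro P.q_invariant)
    with \<Phi>(2)[OF \<tau>] \<kappa>r show ?thesis by simp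
  qed
  then show thesis by (rule that)
qed

text \<open>The shift normalises the group; conjugating the matrix with rows (1, 0) and (N, 1)
  forces it to be integral.\<close>

lemma shift_integral:
  assumes "cusp_covering N \<Omega> p" "cusp_covering N \<Omega> p'"
    and shift: "\<And>\<tau>. \<tau> \<in> \<H> \<Longrightarrow> p' \<tau> = p (\<tau> + of_real k)"
  shows "k \<in> \<int>"
proof -
  interpret P: cusp_covering N \<Omega> p by fact
  interpret P': cusp_covering N \<Omega> p' by fact
  define \<gamma> where "\<gamma> \<tau> = \<tau> / (of_nat N * \<tau> + 1)" for \<tau> :: complex
  have \<gamma>_mat: "\<gamma> \<tau> = moebius (mat2 1 0 (int N) 1) \<tau>" for \<tau>
    by (simp add: \<gamma>_def moebius_mat2)
  have nz\<gamma>: "of_nat N * \<tau> + 1 \<noteq> 0" if "\<tau> \<in> \<H>" for \<tau> :: complex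
    using moebius_denominator_nonzero[of 1 1 0 "int N" \<tau>] that by (simp add: in_upper_half_plane_iff)
  have Im\<gamma>: "Im (\<gamma> \<tau>) = Im \<tau> / (norm (of_nat N * \<tau> + 1))\<^sup>2" if "\<tau> \<in> \<H>" for \<tau>
    using Im_moebius[of 1 1 0 "int N" \<tau>] that by (simp add: in_upper_half_plane_iff \<gamma>_def)
  have \<gamma>H: "\<gamma> \<tau> \<in> \<H>" if "\<tau> \<in> \<H>" for \<tau>
    using Im\<gamma>[OF that] nz\<gamma>[OF that] that by (simp add: in_upper_half_plane_iff)
  have \<gamma>inv: "p (\<gamma> \<tau> + of_real k) = p (\<tau> + of_real k)" if \<tau>: "\<tau> \<in> \<H>" for \<tau>
  proof -
    have "mat2 1 0 (int N) 1 \<in> principal_congruence_matrices N"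
      by (rule mat2_in_principal) (auto simp: cong_0_iff)
    from P'.invariant[OF this \<tau>] have "p' (\<gamma> \<tau>) = p' \<tau>" by (simp add: \<gamma>_mat)
    then show ?thesis using shift[OF \<tau>] shift[OF \<gamma>H[OF \<tau>]] by simp
  qed
  have kH: "\<tau> + of_real k \<in> \<H>" if "\<tau> \<in> \<H>" for \<tau>
    using that by (simp add: in_upper_half_plane_iff)
  have iH: "\<i> \<in> \<H>" by (simp add: in_upper_half_plane_iff)
  obtain M where M: "M \<in> principal_congruence_matrices N" "\<gamma> \<i> + of_real k = moebius M (\<i> + of_real k)"
    using P.fibre[OF kH[OF iH] kH[OF \<gamma>H[OF iH]]] \<gamma>inv[OF iH] by auto
  from M(1) obtain a b c d :: int where
    abcd: "\<And>\<tau>. moebius M \<tau> = (of_int a * \<tau> + of_int b) / (of_int c * \<tau> + of_int d)"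
    "a * d - b * c = 1" "int N dvd b"
    by (rule principal_congruence_cases) metis
  have nzM: "of_int c * \<tau> + of_int d \<noteq> (0::complex)" if "\<tau> \<in> \<H>" for \<tau>
    using moebius_denominator_nonzero[OF abcd(2), of \<tau>] that by (simp add: in_upper_half_plane_iff)
  have ImM: "Im (moebius M \<tau>) = Im \<tau> / (norm (of_int c * \<tau> + of_int d))\<^sup>2" if "\<tau> \<in> \<H>" for \<tau>
    using Im_moebius[OF abcd(2), of \<tau>] that abcd(1) by (simp add: in_upper_half_plane_iff)
  have MH: "moebius M \<tau> \<in> \<H>" if "\<tau> \<in> \<H>" for \<tau>
    using ImM[OF that] nzM[OF that] that by (simp add: in_upper_half_plane_iff)
  \<comment> \<open>M was obtained at the single point i. Both sides lift the same map through p and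
    agree at i, so the same M works everywhere.\<close>
  have eq: "\<gamma> \<tau> + of_real k = moebius M (\<tau> + of_real k)" if \<tau>: "\<tau> \<in> \<H>" for \<tau>
  proof (rule covering_space_lift_unique[OF P.cov, of "\<lambda>\<tau>. \<gamma> \<tau> + of_real k" \<i> "\<lambda>\<tau>. moebius M (\<tau> + of_real k)" \<H> "\<lambda>\<tau>. p (\<tau> + of_real k)"])
    have "(\<lambda>\<tau>. \<tau> + of_real k) ` \<H> \<subseteq> \<H>" using kH by blast
    then show "continuous_on \<H> (\<lambda>\<tau>. p (\<tau> + of_real k))"
      by (intro continuous_on_compose2[OF holomorphic_on_imp_continuous_on[OF P.holo]] continuous_intros)
    show "continuous_on \<H> (\<lambda>\<tau>. \<gamma> \<tau> + of_real k)"
      unfolding \<gamma>_def using nz\<gamma> by (intro continuous_intros) auto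
    show "continuous_on \<H> (\<lambda>\<tau>. moebius M (\<tau> + of_real k))"
      unfolding abcd(1) using nzM[OF kH] by (intro continuous_intros) auto
    show "connected \<H>" by (rule convex_connected[OF convex_upper_half_plane])
    show "(\<lambda>\<tau>. p (\<tau> + of_real k)) \<in> \<H> \<rightarrow> \<Omega>" using P.in_range kH by blast
    show "(\<lambda>\<tau>. \<gamma> \<tau> + of_real k) \<in> \<H> \<rightarrow> \<H>" using kH \<gamma>H by blast
    show "(\<lambda>\<tau>. moebius M (\<tau> + of_real k)) \<in> \<H> \<rightarrow> \<H>" using kH MH by blast
    show "p (x + of_real k) = p (\<gamma> x + of_real k)" if "x \<in> \<H>" for x using \<gamma>inv[OF that] by simp
    show "p (x + of_real k) = p (moebius M (x + of_real k))" if "x \<in> \<H>" for x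
      using P.invariant[OF M(1) kH[OF that]] by simp
  qed (use M(2) iH \<tau> in auto)
  \<comment> \<open>Equal imaginary parts mean equal norms of the denominators. The resulting
    identity at the points i, 2i and 1 + i yields c^2 = N^2, (c k + d)^2 = 1 and N = c (c k +
    d).\<close>
  have norm_eq: "(N * x + 1)\<^sup>2 + (N * y)\<^sup>2 = (c * (x + k) + d)\<^sup>2 + (c * y)\<^sup>2" if y: "y > 0" for x y :: real
  proof -
    let ?\<tau> = "Complex x y"
    have \<tau>: "?\<tau> \<in> \<H>" using y by (simp add: in_upper_half_plane_iff)
    have "Im ?\<tau> / (norm (of_nat N * ?\<tau> + 1))\<^sup>2 = Im ?\<tau> / (norm (of_int c * (?\<tau> + of_real k) + of_int d))\<^sup>2"
      using arg_cong[OF eq[OF \<tau>], of Im] Im\<gamma>[OF \<tau>] ImM[OF kH[OF \<tau>]] by simp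
    then have "(norm (of_nat N * ?\<tau> + 1))\<^sup>2 = (norm (of_int c * (?\<tau> + of_real k) + of_int d))\<^sup>2"
      using y nz\<gamma>[OF \<tau>] nzM[OF kH[OF \<tau>]] by (simp add: divide_simps split: if_splits)
    then show ?thesis by (simp add: cmod_power2)
  qed
  have c2: "(real N)\<^sup>2 = (of_int c)\<^sup>2"
    using norm_eq[of 1 0] norm_eq[of 2 0] by (simp add: power_mult_distrib)
  have d2: "(c * k + d)\<^sup>2 = 1" using norm_eq[of 1 0] c2 by (simp add: power_mult_distrib)
  have "real N * 1 = c * (c * k + d)"
    using norm_eq[of 1 1] c2 d2 by (simp add: power2_eq_square algebra_simps)
  then have c: "c = (c * k + d) * N" "(c * k + d) = 1 \<or> (c * k + d) = -1"
    using d2 by (auto simp: power2_eq_1_iff)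
  define \<sigma> :: int where "\<sigma> = (if c * k + d = 1 then 1 else -1)"
  have \<sigma>: "of_int \<sigma> = c * k + d" "\<sigma> * \<sigma> = 1" using c(2) by (auto simp: \<sigma>_def)
  have c\<sigma>: "c = \<sigma> * int N"
  proof -
    have "real_of_int c = real_of_int (\<sigma> * int N)" using c(1) \<sigma>(1) by simp
    then show ?thesis by (simp only: of_int_eq_iff)
  qed
  \<comment> \<open>Multiplying c k + d = \<sigma> by \<sigma> gives N k = 1 - \<sigma> d. So N k is
    an integer m, and what remains is that N divides m.\<close>
  define m where "m = 1 - \<sigma> * d"
  have m: "of_int m = N * k"
  proof -
    have "real_of_int (\<sigma> * \<sigma>) = \<sigma> * (\<sigma> * int N * k + d)"
      using \<sigma>(1) c\<sigma> by simp
    also have "\<dots> = real_of_int (\<sigma> * \<sigma>) * (N * k) + \<sigma> * d" by (simp add: algebra_simps)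
    finally show ?thesis unfolding m_def \<sigma>(2) by simp
  qed
  \<comment> \<open>The denominators of the two sides differ by the factor \<sigma> only. Clearing
    them leaves affine functions of \<tau>, whose coefficients determine a and b.\<close>
  have lin: "of_int a * \<tau> + (of_int a * of_real k + of_int b) = of_int (\<sigma> * (1 + m)) * \<tau> + of_int \<sigma> * of_real k"
    if \<tau>: "\<tau> \<in> \<H>" for \<tau> :: complex
  proof -
    have den: "of_int c * (\<tau> + of_real k) + of_int d = of_int \<sigma> * (of_nat N * \<tau> + 1)"
    proof -
      have "complex_of_real (of_int \<sigma>) = of_real (c * k + d)" using \<sigma>(1) by simp
      then have "of_int c * of_real k + of_int d = (of_int \<sigma> :: complex)" by simp
      moreover have "of_int c * (\<tau> + of_real k) + of_int d = of_int c * \<tau> + (of_int c * of_real k + of_int d)"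
        by (simp add: ring_distribs)
      ultimately show ?thesis using c\<sigma> by (simp add: ring_distribs)
    qed
    have "of_int a * (\<tau> + of_real k) + of_int b = (\<gamma> \<tau> + of_real k) * (of_int c * (\<tau> + of_real k) + of_int d)"
      using eq[OF \<tau>] nzM[OF kH[OF \<tau>]] abcd(1) by simp
    also have "\<dots> = of_int \<sigma> * (\<tau> + of_real k * (of_nat N * \<tau> + 1))"
      unfolding den \<gamma>_def using nz\<gamma>[OF \<tau>] by (simp add: field_simps)
    also have "\<dots> = of_int \<sigma> * (\<tau> + of_real (N * k) * \<tau> + of_real k)"
      by (simp add: algebra_simps)
    also have "complex_of_real (N * k) = of_int m" using m by (metis of_real_of_int_eq)
    finally show ?thesis by (simp add: algebra_simps)
  qed
  define X s Z :: complex where "X = of_int a * of_real k + of_int b" and "s = of_int (\<sigma> * (1 + m))"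
    and "Z = of_int \<sigma> * of_real k"
  have "2 * \<i> \<in> \<H>" by (simp add: in_upper_half_plane_iff)
  note two = lin[OF this, folded X_def s_def Z_def] lin[OF iH, folded X_def s_def Z_def]
  have "of_int a * \<i> = (of_int a * (2 * \<i>) + X) - (of_int a * \<i> + X)" by simp
  also have "\<dots> = s * \<i>" unfolding two by simp
  finally have "of_int a * \<i> = of_int (\<sigma> * (1 + m)) * \<i>" unfolding s_def .
  then have "(of_int a :: complex) = of_int (\<sigma> * (1 + m))" by (metis complex_i_not_zero mult_cancel_right)
  then have a: "a = \<sigma> * (1 + m)" by (simp only: of_int_eq_iff)
  from lin[OF iH] a have "of_int a * of_real k + of_int b = of_int \<sigma> * complex_of_real k" by simp
  then have "complex_of_real (a * k + b) = of_real (\<sigma> * k)" by simp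
  then have "a * k + b = \<sigma> * k" by (simp only: of_real_eq_iff)
  then have "real_of_int b = - (\<sigma> * m) * k" unfolding a by (simp add: algebra_simps)
  then have "real_of_int b * N = - (\<sigma> * m) * (N * k)" by simp
  then have "real_of_int (b * int N) = of_int (- (\<sigma> * m) * m)" using m by simp
  then have bN: "b * int N = - (\<sigma> * m) * m" by (simp only: of_int_eq_iff)
  \<comment> \<open>The congruence for b supplies the second factor N: b N = - \<sigma> m^2 becomes
    divisibility of m^2 by N^2, which descends to m and N.\<close>
  obtain b' where b': "b = int N * b'" using abcd(3) by auto
  have "m\<^sup>2 = (\<sigma> * \<sigma>) * m\<^sup>2" using \<sigma>(2) by simp
  also have "\<dots> = - \<sigma> * (- (\<sigma> * m) * m)" by (simp add: power2_eq_square)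
  also have "\<dots> = - \<sigma> * (b * int N)" by (simp only: bN)
  also have "\<dots> = (int N)\<^sup>2 * (- \<sigma> * b')" using b' by (simp add: power2_eq_square)
  finally have "m\<^sup>2 = (int N)\<^sup>2 * (- \<sigma> * b')" .
  then have "(int N)\<^sup>2 dvd m\<^sup>2" by simp
  then have "int N dvd m" by simp
  then obtain j where "m = int N * j" by auto
  with m have "k = of_int j" using P.N_pos by simp
  then show ?thesis by simp
qed

section \<open>The cusp at 0\<close>

text \<open>By the open mapping theorem u takes every value near l other than l itself, and v has
  such a value arbitrarily near 0.\<close>

lemma common_value_near_limit:
  assumes u: "u holomorphic_on ball 0 r - {0}" "(u \<longlongrightarrow> l) (at 0)"
    and v: "(v \<longlongrightarrow> l) (at (0::complex))" and "r > 0" "\<epsilon> > 0"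
    and nu: "\<And>\<epsilon>. \<epsilon> > 0 \<Longrightarrow> \<exists>q. q \<noteq> 0 \<and> norm q < \<epsilon> \<and> u q \<noteq> l"
    and nv: "\<And>\<epsilon>. \<epsilon> > 0 \<Longrightarrow> \<exists>q. q \<noteq> 0 \<and> norm q < \<epsilon> \<and> v q \<noteq> l"
  obtains q q' where "q \<noteq> 0" "norm q < \<epsilon>" "q' \<noteq> 0" "norm q' < \<epsilon>" "u q = v q'"
proof -
  have "\<forall>\<^sub>F w in at l. \<exists>q. q \<noteq> 0 \<and> norm q < \<epsilon> \<and> u q = w"
    by (rule holomorphic_punctured_values[OF u(1) \<open>r > 0\<close> u(2) nu \<open>\<epsilon> > 0\<close>])
  then have "\<forall>\<^sub>F w in nhds l. w \<noteq> l \<longrightarrow> (\<exists>q. q \<noteq> 0 \<and> norm q < \<epsilon> \<and> u q = w)"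
    by (simp add: eventually_at_filter)
  then have "\<forall>\<^sub>F q' in at 0. v q' \<noteq> l \<longrightarrow> (\<exists>q. q \<noteq> 0 \<and> norm q < \<epsilon> \<and> u q = v q')"
    using v by (rule eventually_compose_filterlim)
  then obtain \<delta> where \<delta>: "\<delta> > 0" "\<And>q'. q' \<noteq> 0 \<Longrightarrow> norm q' < \<delta> \<Longrightarrow> v q' \<noteq> l \<Longrightarrow> \<exists>q. q \<noteq> 0 \<and> norm q < \<epsilon> \<and> u q = v q'"
    by (auto simp: eventually_at)
  obtain q' where "q' \<noteq> 0" "norm q' < min \<delta> \<epsilon>" "v q' \<noteq> l" using nv[of "min \<delta> \<epsilon>"] \<delta>(1) \<open>\<epsilon> > 0\<close> by auto
  with \<delta>(2)[of q'] that show thesis by auto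
qed

lemma upper_half_plane_inversion: "\<tau> \<in> \<H> \<Longrightarrow> - 1 / \<tau> \<in> \<H>"
  by (auto simp: in_upper_half_plane_iff Im_divide zero_less_divide_iff sum_power2_gt_zero_iff)

context cusp_covering
begin

text \<open>Conjugating by the inversion turns the fibre condition into one on horoballs at infinity.\<close>

lemma horoball_at_0_fibre:
  assumes \<tau>: "Im \<tau> > 1" "Im \<tau>' > 1" and eq: "p (- 1 / \<tau>) = p (- 1 / \<tau>' + of_int k)"
  shows "int N dvd k" "Im \<tau> = Im \<tau>'"
proof -
  have "\<tau> \<in> \<H>" "\<tau>' \<in> \<H>" using \<tau> by (auto simp: in_upper_half_plane_iff)
  then have inH: "- 1 / \<tau> \<in> \<H>" "- 1 / \<tau>' + of_int k \<in> \<H>"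
    using upper_half_plane_inversion by (auto simp: in_upper_half_plane_iff)
  obtain M where M: "M \<in> principal_congruence_matrices N" "- 1 / \<tau>' + of_int k = moebius M (- 1 / \<tau>)"
    using fibre[OF inH eq] by blast
  from M(1) obtain a b c d :: int where
    abcd: "\<And>\<tau>. moebius M \<tau> = (of_int a * \<tau> + of_int b) / (of_int c * \<tau> + of_int d)"
    "a * d - b * c = 1" "int N dvd b"
    "[a = 1] (mod int N) \<and> [d = 1] (mod int N) \<or> [a = -1] (mod int N) \<and> [d = -1] (mod int N)"
    by (rule principal_congruence_cases) metis
  have nz: "\<tau> \<noteq> 0" "\<tau>' \<noteq> 0" using \<tau> by auto
  \<comment> \<open>The matrix with rows (-d, c) and (b - k d, -a + k c) expresses \<tau>' by
    \<tau>: it is M conjugated by the inversion, with the shift by k absorbed.\<close>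
  have det: "- d * (- a + k * c) - c * (b - k * d) = 1" using abcd(2) by (simp add: algebra_simps)
  have den: "of_int d * \<tau> - of_int c \<noteq> 0"
    using moebius_denominator_nonzero[of b "- c" "- a" d \<tau>] abcd(2) \<tau>(1) by (simp add: algebra_simps)
  have den': "of_int (b - k * d) * \<tau> + of_int (- a + k * c) \<noteq> 0"
    by (rule moebius_denominator_nonzero[OF det]) (use \<tau>(1) in simp)
  have "moebius M (- 1 / \<tau>) = (of_int b * \<tau> - of_int a) / (of_int d * \<tau> - of_int c)"
    unfolding abcd(1) using nz(1) by (simp add: divide_simps)
  then have "- 1 / \<tau>' = (of_int b * \<tau> - of_int a) / (of_int d * \<tau> - of_int c) - of_int k"
    using M(2) by (simp add: algebra_simps)
  also have "\<dots> = (of_int (b - k * d) * \<tau> + of_int (- a + k * c)) / (of_int d * \<tau> - of_int c)"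
    using den by (simp add: field_simps)
  finally have \<tau>': "\<tau>' = (of_int (- d) * \<tau> + of_int c) / (of_int (b - k * d) * \<tau> + of_int (- a + k * c))"
    using nz den den' by (simp add: divide_simps)
  \<comment> \<open>This is the lower left entry of the conjugated matrix. As N divides b and d is 1
    or -1 modulo N, it makes N divide k; the conjugated map is then a translation, so heights
    agree.\<close>
  have 0: "b - k * d = 0"
    using moebius_horoball[OF det \<tau>(1)] \<tau>(2) \<tau>' by simp
  have "coprime (int N) d"
  proof -
    have "[d = 1] (mod int N) \<or> [d = -1] (mod int N)" using abcd(4) by blast
    then show ?thesis
      using cong_imp_coprime[of 1 d "int N"] cong_imp_coprime[of "-1" d "int N"]
      by (auto simp: coprime_commute cong_sym_eq)
  qed
  moreover have "int N dvd k * d" using 0 abcd(3) by simp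
  ultimately show "int N dvd k" by (simp add: coprime_dvd_mult_left_iff)
  from det 0 have "d * (a - k * c) = 1" by (simp add: algebra_simps)
  then have "d = a - k * c" "d = 1 \<or> d = -1" by (auto simp: zmult_eq_1_iff)
  then have "\<tau>' = (of_int (- d) * \<tau> + of_int c) / of_int (- d)" "d \<noteq> 0"
    using \<tau>' unfolding 0 by auto
  then have "\<tau>' = \<tau> - of_int c / of_int d" by (simp add: field_simps)
  then show "Im \<tau> = Im \<tau>'" using \<open>d = 1 \<or> d = -1\<close> by auto
qed

text \<open>F omits two values on the punctured disc, so by the great Picard theorem its singularity
  at 0 is not essential. Which of the two cases holds depends on whether the puncture at the cusp 0
  is finite in the coordinate p.\<close>

lemma cusp_0:
  obtains F where "F holomorphic_on ball 0 1 - {0}" "\<And>\<tau>. \<tau> \<in> \<H> \<Longrightarrow> F (q_param N \<tau>) = p (- 1 / \<tau>)"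
    "\<And>q. q \<noteq> 0 \<Longrightarrow> norm q < 1 \<Longrightarrow> F q \<in> \<Omega>"
    "\<And>l \<epsilon>. \<epsilon> > 0 \<Longrightarrow> \<exists>q. q \<noteq> 0 \<and> norm q < \<epsilon> \<and> F q \<noteq> l"
    "(\<exists>l. (F \<longlongrightarrow> l) (at 0)) \<or> filterlim F at_infinity (at 0)"
proof -
  have sub: "(\<lambda>\<tau>. - 1 / \<tau>) ` \<H> \<subseteq> \<H>" using upper_half_plane_inversion by blast
  have "(\<lambda>\<tau>. - 1 / \<tau>) holomorphic_on \<H>"
    by (intro holomorphic_intros) (auto simp: in_upper_half_plane_iff)
  from holomorphic_on_compose_gen[OF this holo sub]
  have hol: "(\<lambda>\<tau>. p (- 1 / \<tau>)) holomorphic_on {\<tau>. Im \<tau> > 0}"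
    by (simp add: o_def upper_half_plane_def)
  have "p (- 1 / \<tau>) = p (- 1 / \<tau>')" if \<tau>: "Im \<tau> > 0" "Im \<tau>' > 0" "q_param N \<tau> = q_param N \<tau>'" for \<tau> \<tau>'
  proof -
    obtain k :: int where k: "\<tau>' = \<tau> + of_nat N * of_int k"
      using \<tau>(3) q_param_eq_iff[OF N_pos] by blast
    \<comment> \<open>The inversion conjugates the translation by N k into this matrix.\<close>
    have "mat2 1 0 (- int N * k) 1 \<in> principal_congruence_matrices N"
      by (rule mat2_in_principal) (auto simp: cong_0_iff)
    from invariant[OF this upper_half_plane_inversion, of \<tau>]
    have "p (moebius (mat2 1 0 (- int N * k) 1) (- 1 / \<tau>)) = p (- 1 / \<tau>)"
      using \<tau>(1) by (simp add: in_upper_half_plane_iff)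
    also have "moebius (mat2 1 0 (- int N * k) 1) (- 1 / \<tau>) = - 1 / \<tau>'"
    proof -
      have "\<tau> \<noteq> 0" "\<tau>' \<noteq> 0" using \<tau> by auto
      moreover have "of_int (- int N * k) * (- 1 / \<tau>) + 1 = \<tau>' / \<tau>"
        using \<open>\<tau> \<noteq> 0\<close> k by (simp add: field_simps)
      ultimately show ?thesis by (simp only: moebius_mat2) simp
    qed
    finally show ?thesis by simp
  qed
  from descend_q_param[OF N_pos hol this]
  obtain F where "F holomorphic_on ball 0 (exp (- (2 * pi / N * 0))) - {0}"
    and F2: "\<And>\<tau>. Im \<tau> > 0 \<Longrightarrow> F (q_param N \<tau>) = p (- 1 / \<tau>)" by blast
  then have F: "F holomorphic_on ball 0 1 - {0}" by simp
  have range: "F q \<in> \<Omega>" if q: "q \<noteq> 0" "norm q < 1" for q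
  proof -
    obtain \<tau> where \<tau>: "q_param N \<tau> = q" using q_param_surj[OF N_pos q(1)] by blast
    then have "Im \<tau> > 0" using norm_q_param_less_iff[OF N_pos, of \<tau> 0] q(2) by simp
    then show ?thesis
      using F2[of \<tau>] \<tau> in_range[OF upper_half_plane_inversion[of \<tau>]] by (simp add: in_upper_half_plane_iff)
  qed
  have nonconst: "\<exists>q. q \<noteq> 0 \<and> norm q < \<epsilon> \<and> F q \<noteq> l" if "\<epsilon> > 0" for l \<epsilon>
  proof (rule ccontr)
    assume *: "\<not> ?thesis"
    have "\<forall>\<^sub>F q in at 0. norm (q :: complex) < \<epsilon>"
      using that by (auto simp: eventually_at)
    then have "\<forall>\<^sub>F \<tau> in Im_at_top. norm (q_param N \<tau>) < \<epsilon>"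
      unfolding eventually_at_0_q_param[OF N_pos] .
    then obtain y where y: "\<And>\<tau>. Im \<tau> > y \<Longrightarrow> norm (q_param N \<tau>) < \<epsilon>"
      unfolding eventually_Im_at_top by blast
    define t where "t = max y 1"
    have const: "p (- 1 / \<tau>) = l" if "Im \<tau> > t" for \<tau>
      using F2[of \<tau>] * y[of \<tau>] that by (auto simp: t_def)
    \<comment> \<open>Two points at different heights with equal values contradict
      \<open>horoball_at_0_fibre\<close> for k = 0.\<close>
    have "p (- 1 / Complex 0 (t + 1)) = p (- 1 / Complex 0 (t + 2) + of_int 0)"
      using const[of "Complex 0 (t + 1)"] const[of "Complex 0 (t + 2)"] by simp
    then have "Im (Complex 0 (t + 1)) = Im (Complex 0 (t + 2))"
      by (rule horoball_at_0_fibre(2)[rotated 2]) (auto simp: t_def)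
    then show False by simp
  qed
  obtain a b where ab: "a \<noteq> b" "a \<notin> \<Omega>" "b \<notin> \<Omega>" using two_omitted by blast
  have "(\<lambda>q. F q - a) holomorphic_on ball 0 1 - {0}" by (intro holomorphic_intros F)
  moreover have "F w - a \<noteq> 0 \<and> F w - a \<noteq> b - a" if "w \<in> ball 0 1 - {0}" for w
    using range[of w] that ab by auto
  ultimately obtain l where l: "((\<lambda>q. F q - a) \<longlongrightarrow> l) (at 0) \<or> ((inverse \<circ> (\<lambda>q. F q - a)) \<longlongrightarrow> l) (at 0)"
    using great_Picard[of "ball 0 1" 0 0 "b - a" "\<lambda>q. F q - a"] ab(1) by (metis centre_in_ball open_ball right_minus_eq zero_less_one)
  have shift: "\<exists>l. (F \<longlongrightarrow> l) (at 0)" if "((\<lambda>q. F q - a) \<longlongrightarrow> l) (at 0)" for l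
    using tendsto_add[OF that tendsto_const[of a]] by auto
  have "(\<exists>l. (F \<longlongrightarrow> l) (at 0)) \<or> filterlim F at_infinity (at 0)"
    using l
  proof
    assume *: "((inverse \<circ> (\<lambda>q. F q - a)) \<longlongrightarrow> l) (at 0)"
    show ?thesis
    proof (cases "l = 0")
      case False
      from tendsto_inverse[OF * False] have "((\<lambda>q. F q - a) \<longlongrightarrow> inverse l) (at 0)" by simp
      with shift show ?thesis by blast
    next
      case True
      have "\<forall>\<^sub>F q in at 0. q \<in> ball 0 1 - {0 :: complex}"
        by (intro eventually_at_in_open) auto
      then have "\<forall>\<^sub>F q in at 0. (inverse \<circ> (\<lambda>q. F q - a)) q \<noteq> 0"
        by eventually_elim (use range ab in force)
      \<comment> \<open>Since inverse 0 = 0, the limit 0 means a pole only because F omits a and the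
        reciprocals are nonzero.\<close>
      with * True have "filterlim (inverse \<circ> (\<lambda>q. F q - a)) (at 0) (at 0)"
        by (simp add: filterlim_at)
      from filterlim_compose[OF filterlim_inverse_at_infinity this]
      have "filterlim (\<lambda>q. F q - a) at_infinity (at 0)" by simp
      from tendsto_add_filterlim_at_infinity[OF tendsto_const[of a] this]
      show ?thesis by simp
    qed
  qed (use shift in blast)
  with F F2 range nonconst show thesis by (intro that[of F]) (auto simp: in_upper_half_plane_iff)
qed

end

text \<open>Expressed in q, both functions approach the same value at the cusp 0, finite or
  infinite, and so share a value arbitrarily near it.\<close>

lemma common_cusp_value_at_0:
  assumes "cusp_covering N \<Omega> p" "cusp_covering N \<Omega> p'"
    and lim: "\<And>l. ((\<lambda>\<tau>. p (- 1 / \<tau>)) \<longlongrightarrow> l) Im_at_top \<Longrightarrow> ((\<lambda>\<tau>. p' (- 1 / \<tau>)) \<longlongrightarrow> l) Im_at_top"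
    and inf: "filterlim (\<lambda>\<tau>. p (- 1 / \<tau>)) at_infinity Im_at_top \<Longrightarrow>
              filterlim (\<lambda>\<tau>. p' (- 1 / \<tau>)) at_infinity Im_at_top"
  obtains \<tau> \<tau>' where "Im \<tau> > 1" "Im \<tau>' > 1" "p (- 1 / \<tau>) = p' (- 1 / \<tau>')"
proof -
  interpret P: cusp_covering N \<Omega> p by fact
  interpret P': cusp_covering N \<Omega> p' by fact
  obtain F where F: "F holomorphic_on ball 0 1 - {0}" "\<And>\<tau>. \<tau> \<in> \<H> \<Longrightarrow> F (q_param N \<tau>) = p (- 1 / \<tau>)"
    "\<And>q. q \<noteq> 0 \<Longrightarrow> norm q < 1 \<Longrightarrow> F q \<in> \<Omega>"
    "\<And>l \<epsilon>. \<epsilon> > 0 \<Longrightarrow> \<exists>q. q \<noteq> 0 \<and> norm q < \<epsilon> \<and> F q \<noteq> l"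
    "(\<exists>l. (F \<longlongrightarrow> l) (at 0)) \<or> filterlim F at_infinity (at 0)"
    by (rule P.cusp_0) blast
  obtain G where G: "G holomorphic_on ball 0 1 - {0}" "\<And>\<tau>. \<tau> \<in> \<H> \<Longrightarrow> G (q_param N \<tau>) = p' (- 1 / \<tau>)"
    "\<And>q. q \<noteq> 0 \<Longrightarrow> norm q < 1 \<Longrightarrow> G q \<in> \<Omega>"
    "\<And>l \<epsilon>. \<epsilon> > 0 \<Longrightarrow> \<exists>q. q \<noteq> 0 \<and> norm q < \<epsilon> \<and> G q \<noteq> l"
    by (rule P'.cusp_0) blast
  have transfer: "filterlim E K (at 0) \<longleftrightarrow> filterlim (\<lambda>\<tau>. e (- 1 / \<tau>)) K Im_at_top"
    if "\<And>\<tau>. \<tau> \<in> \<H> \<Longrightarrow> E (q_param N \<tau>) = e (- 1 / \<tau>)" for E e :: "complex \<Rightarrow> complex" and K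
    unfolding filterlim_q_param_iff[OF P.N_pos]
  proof (rule filterlim_cong[OF refl refl])
    show "\<forall>\<^sub>F \<tau> in Im_at_top. E (q_param N \<tau>) = e (- 1 / \<tau>)"
      using eventually_Im_at_top_gt[of 0]
      by eventually_elim (rule that, simp add: in_upper_half_plane_iff)
  qed
  \<comment> \<open>The radius for which |q| < \<epsilon> means Im > 1, the horoball that
    \<open>horoball_at_0_fibre\<close> needs.\<close>
  define \<epsilon> where "\<epsilon> = exp (- (2 * pi / N * 1))"
  have \<epsilon>: "\<epsilon> > 0" "\<epsilon> < 1" using P.N_pos by (auto simp: \<epsilon>_def)
  have "\<exists>q q'. q \<noteq> 0 \<and> norm q < \<epsilon> \<and> q' \<noteq> 0 \<and> norm q' < \<epsilon> \<and> F q = G q'"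
    using F(5)
  proof
    assume "\<exists>l. (F \<longlongrightarrow> l) (at 0)"
    then obtain l where l: "(F \<longlongrightarrow> l) (at 0)" by blast
    then have l': "(G \<longlongrightarrow> l) (at 0)" using lim transfer[of F p, OF F(2)] transfer[of G p', OF G(2)] by blast
    show ?thesis
      using common_value_near_limit[OF F(1) l l' zero_less_one \<epsilon>(1) F(4) G(4)] by blast
  next
    assume l: "filterlim F at_infinity (at 0)"
    then have l': "filterlim G at_infinity (at 0)" using inf transfer[of F p, OF F(2)] transfer[of G p', OF G(2)] by blast
    \<comment> \<open>Inverting about an omitted value a turns the common pole into the common limit
      0 without creating new poles.\<close>
    obtain a where a: "a \<notin> \<Omega>" using P.two_omitted by blast
    have inv0: "((\<lambda>q. inverse (E q - a)) \<longlongrightarrow> 0) (at 0)" if "filterlim E at_infinity (at 0)" for E :: "complex \<Rightarrow> complex"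
      using filterlim_compose[OF tendsto_inverse_0 tendsto_add_filterlim_at_infinity[OF tendsto_const[of "- a"] that]]
      by simp
    have "(\<lambda>q. inverse (F q - a)) holomorphic_on ball 0 1 - {0}"
      by (intro holomorphic_intros F(1)) (use F(3) a in auto)
    moreover have nc: "\<exists>q. q \<noteq> 0 \<and> norm q < e \<and> inverse (E q - a) \<noteq> 0"
      if "e > 0" "\<And>q. q \<noteq> 0 \<Longrightarrow> norm q < 1 \<Longrightarrow> E q \<in> \<Omega>" for e and E :: "complex \<Rightarrow> complex"
    proof -
      define q where "q = complex_of_real (min e 1 / 2)"
      have "q \<noteq> 0" "norm q < e" "norm q < 1" using that(1) by (auto simp: q_def)
      with that(2)[of q] a show ?thesis by (intro exI[of _ q]) auto
    qed
    ultimately obtain q q' where "q \<noteq> 0" "norm q < \<epsilon>" "q' \<noteq> 0" "norm q' < \<epsilon>" "inverse (F q - a) = inverse (G q' - a)"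
      using common_value_near_limit[OF _ inv0[OF l] inv0[OF l'] zero_less_one \<epsilon>(1)
          nc[OF _ F(3)] nc[OF _ G(3)]] by blast
    then show ?thesis by (intro exI[of _ q] exI[of _ q']) simp
  qed
  then obtain q q' where q: "q \<noteq> 0" "norm q < \<epsilon>" "q' \<noteq> 0" "norm q' < \<epsilon>" "F q = G q'" by blast
  obtain \<tau> \<tau>' where \<tau>: "q_param N \<tau> = q" "q_param N \<tau>' = q'"
    using q_param_surj[OF P.N_pos] q(1,3) by metis
  have Im: "Im \<tau> > 1" "Im \<tau>' > 1"
    using norm_q_param_less_iff[OF P.N_pos, of _ 1] q(2,4) \<tau> unfolding \<epsilon>_def by blast+
  moreover have "p (- 1 / \<tau>) = p' (- 1 / \<tau>')"
    using F(2)[of \<tau>] G(2)[of \<tau>'] Im \<tau> q(5) by (simp add: in_upper_half_plane_iff)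
  ultimately show thesis by (rule that)
qed

section \<open>Expansions at infinity\<close>

text \<open>A condition near the cusp only, which can be read off both from a covering and from
  \<open>has_expansion\<close>; uniqueness of power series then identifies the coefficients.\<close>

definition cusp_fps :: "nat \<Rightarrow> (complex \<Rightarrow> complex) \<Rightarrow> complex fps \<Rightarrow> bool" where
  "cusp_fps N p X \<longleftrightarrow>
     fps_nth X 0 = 0 \<and> (\<forall>\<^sub>F \<tau> in Im_at_top. (\<lambda>k. fps_nth X k * q_param N \<tau> ^ k) sums (1 / p \<tau>))"

lemma has_fps_expansion_if_eventually_sums:
  fixes E :: "complex \<Rightarrow> complex"
  assumes "\<forall>\<^sub>F q in at 0. (\<lambda>k. fps_nth X k * q ^ k) sums E q" "fps_nth X 0 = E 0"
  shows "E has_fps_expansion X"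
proof -
  obtain \<rho> where \<rho>: "\<rho> > 0" "\<And>q. q \<noteq> 0 \<Longrightarrow> norm q < \<rho> \<Longrightarrow> (\<lambda>k. fps_nth X k * q ^ k) sums E q"
    using assms(1) by (auto simp: eventually_at)
  show ?thesis
  proof (rule has_fps_expansion_if_sums[OF \<rho>(1)])
    fix q :: complex assume "norm q < \<rho>"
    then show "(\<lambda>k. fps_nth X k * q ^ k) sums E q"
      using \<rho>(2)[of q] powser_sums_zero[of "fps_nth X"] assms(2) by (cases "q = 0") auto
  qed
qed

lemma cusp_fps_function:
  assumes N: "N > 0" and X: "cusp_fps N p X"
  obtains F where "F has_fps_expansion X" "F 0 = 0" "\<forall>\<^sub>F \<tau> in Im_at_top. F (q_param N \<tau>) = 1 / p \<tau>"
proof -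
  define F where "F q = (\<Sum>k. fps_nth X k * q ^ k)" for q
  have ev: "\<forall>\<^sub>F \<tau> in Im_at_top. (\<lambda>k. fps_nth X k * q_param N \<tau> ^ k) sums (1 / p \<tau>)"
    using X by (simp add: cusp_fps_def)
  have F0: "F 0 = 0"
    using X powser_sums_zero[of "fps_nth X"] by (auto simp: F_def cusp_fps_def sums_iff)
  have "\<forall>\<^sub>F \<tau> in Im_at_top. (\<lambda>k. fps_nth X k * q_param N \<tau> ^ k) sums F (q_param N \<tau>)"
    using ev by eventually_elim (simp add: F_def sums_iff)
  then have "\<forall>\<^sub>F q in at 0. (\<lambda>k. fps_nth X k * q ^ k) sums F q"
    unfolding eventually_at_0_q_param[OF N] .
  then have "F has_fps_expansion X"
    by (rule has_fps_expansion_if_eventually_sums) (use F0 X in \<open>simp add: cusp_fps_def\<close>)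
  moreover have "\<forall>\<^sub>F \<tau> in Im_at_top. F (q_param N \<tau>) = 1 / p \<tau>"
    using ev by eventually_elim (simp add: F_def sums_iff)
  ultimately show thesis using F0 that by blast
qed

lemma eventually_nhds_0_if_Im_at_top:
  assumes "N > 0" "P 0" "\<forall>\<^sub>F \<tau> in Im_at_top. P (q_param N \<tau>)"
  shows "\<forall>\<^sub>F q in nhds 0. P q"
proof -
  have "\<forall>\<^sub>F q in at 0. P q" unfolding eventually_at_0_q_param[OF assms(1)] by fact
  then have "\<forall>\<^sub>F q in nhds 0. q \<noteq> 0 \<longrightarrow> P q" by (simp add: eventually_at_filter)
  then show ?thesis by eventually_elim (use assms(2) in auto)
qed

lemma cusp_fps_unique:
  assumes N: "N > 0" and "cusp_fps N p X" "cusp_fps N p Y"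
  shows "X = Y"
proof -
  obtain F where F: "F has_fps_expansion X" "F 0 = 0" "\<forall>\<^sub>F \<tau> in Im_at_top. F (q_param N \<tau>) = 1 / p \<tau>"
    by (rule cusp_fps_function[OF N assms(2)])
  obtain G where G: "G has_fps_expansion Y" "G 0 = 0" "\<forall>\<^sub>F \<tau> in Im_at_top. G (q_param N \<tau>) = 1 / p \<tau>"
    by (rule cusp_fps_function[OF N assms(3)])
  have "\<forall>\<^sub>F \<tau> in Im_at_top. F (q_param N \<tau>) = G (q_param N \<tau>)"
    using F(3) G(3) by eventually_elim simp
  then have "\<forall>\<^sub>F q in nhds 0. F q = G q"
    by (intro eventually_nhds_0_if_Im_at_top[OF N]) (use F(2) G(2) in auto)
  then have "G has_fps_expansion X" using F(1) by (metis has_fps_expansion_cong)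
  then show ?thesis using G(1) by (rule fps_expansion_unique_complex)
qed

lemma eventually_nonzero_if_at_infinity:
  assumes "filterlim (p :: complex \<Rightarrow> complex) at_infinity G"
  shows "\<forall>\<^sub>F \<tau> in G. p \<tau> \<noteq> 0"
proof -
  have "\<forall>\<^sub>F \<tau> in G. 1 \<le> norm (p \<tau>)"
    using assms unfolding filterlim_at_infinity[OF order.refl] by simp
  then show ?thesis by eventually_elim auto
qed

lemma cusp_covering_fps:
  assumes "cusp_covering N \<Omega> p"
  obtains X where "cusp_fps N p X" "fps_nth X 1 \<noteq> 0"
    "\<And>y \<tau>. y \<ge> 0 \<Longrightarrow> (\<And>\<tau>. Im \<tau> > y \<Longrightarrow> p \<tau> \<noteq> 0) \<Longrightarrow> Im \<tau> > y \<Longrightarrow>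
       (\<lambda>k. fps_nth X k * q_param N \<tau> ^ k) sums (1 / p \<tau>)"
proof -
  interpret cusp_covering N \<Omega> p by fact
  obtain X F r where X: "r > 0" "F holomorphic_on ball 0 r" "F has_fps_expansion X" "F 0 = 0"
    "fps_nth X 0 = 0" "fps_nth X 1 \<noteq> 0"
    "\<And>\<tau>. norm (q_param N \<tau>) < r \<Longrightarrow> Im \<tau> > 1 \<and> p \<tau> \<noteq> 0 \<and> F (q_param N \<tau>) = 1 / p \<tau>"
    and sums: "\<And>y \<tau>. y \<ge> 0 \<Longrightarrow> (\<And>\<tau>. Im \<tau> > y \<Longrightarrow> p \<tau> \<noteq> 0) \<Longrightarrow> Im \<tau> > y \<Longrightarrow>
       (\<lambda>k. fps_nth X k * q_param N \<tau> ^ k) sums (1 / p \<tau>)"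
    by (rule fps_at_cusp) blast
  obtain y where y: "\<And>\<tau>. Im \<tau> > y \<Longrightarrow> p \<tau> \<noteq> 0"
    using eventually_nonzero_if_at_infinity[OF at_cusp] unfolding eventually_Im_at_top by blast
  have "\<forall>\<^sub>F \<tau> in Im_at_top. (\<lambda>k. fps_nth X k * q_param N \<tau> ^ k) sums (1 / p \<tau>)"
    using eventually_Im_at_top_gt[of "max y 0"]
    by eventually_elim (rule sums[of "max y 0"], use y in auto)
  then show thesis using X(5,6) sums by (intro that[of X]) (auto simp: cusp_fps_def)
qed

text \<open>Dividing p' = \<alpha> p + \<beta> by p p' gives (1 / p') (\<alpha> + \<beta> / p) = 1 /
  p, an identity between germs in q.\<close>

lemma cusp_fps_affine:
  assumes N: "N > 0" and inf: "filterlim p at_infinity Im_at_top" "filterlim p' at_infinity Im_at_top"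
    and H: "cusp_fps N p H" and X: "cusp_fps N p' X"
    and aff: "\<And>\<tau>. \<tau> \<in> \<H> \<Longrightarrow> p' \<tau> = \<alpha> * p \<tau> + \<beta>"
  shows "X * (fps_const \<alpha> + fps_const \<beta> * H) = H"
proof -
  obtain F where F: "F has_fps_expansion H" "F 0 = 0" "\<forall>\<^sub>F \<tau> in Im_at_top. F (q_param N \<tau>) = 1 / p \<tau>"
    by (rule cusp_fps_function[OF N H])
  obtain G where G: "G has_fps_expansion X" "G 0 = 0" "\<forall>\<^sub>F \<tau> in Im_at_top. G (q_param N \<tau>) = 1 / p' \<tau>"
    by (rule cusp_fps_function[OF N X])
  have "\<forall>\<^sub>F \<tau> in Im_at_top. G (q_param N \<tau>) * (\<alpha> + \<beta> * F (q_param N \<tau>)) = F (q_param N \<tau>)"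
    using F(3) G(3) eventually_nonzero_if_at_infinity[OF inf(1)]
      eventually_nonzero_if_at_infinity[OF inf(2)] eventually_Im_at_top_gt[of 0]
  proof eventually_elim
    case (elim \<tau>)
    have "p' \<tau> = \<alpha> * p \<tau> + \<beta>" using elim(5) by (intro aff) (simp add: in_upper_half_plane_iff)
    then have "\<alpha> + \<beta> * (1 / p \<tau>) = p' \<tau> / p \<tau>" using elim(3) by (simp add: field_simps)
    with elim(1-4) show ?case by simp
  qed
  then have "\<forall>\<^sub>F q in nhds 0. G q * (\<alpha> + \<beta> * F q) = F q"
    by (intro eventually_nhds_0_if_Im_at_top[OF N]) (use F(2) G(2) in auto)
  moreover have "(\<lambda>q. G q * (\<alpha> + \<beta> * F q)) has_fps_expansion X * (fps_const \<alpha> + fps_const \<beta> * H)"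
    by (intro fps_expansion_intros F(1) G(1))
  ultimately have "F has_fps_expansion X * (fps_const \<alpha> + fps_const \<beta> * H)"
    by (metis has_fps_expansion_cong)
  then show ?thesis using F(1) by (rule fps_expansion_unique_complex)
qed

text \<open>Translation by k multiplies q by the constant \<open>q_param N (of_real k)\<close>, so
  the j-th coefficient acquires its j-th power.\<close>

lemma cusp_fps_shift:
  assumes X: "cusp_fps N p X" and shift: "\<And>\<tau>. \<tau> \<in> \<H> \<Longrightarrow> p' \<tau> = p (\<tau> + of_real k)"
  shows "cusp_fps N p' (Abs_fps (\<lambda>j. fps_nth X j * q_param N (of_real k) ^ j))"
proof -
  obtain y where y: "\<And>\<tau>. Im \<tau> > y \<Longrightarrow> (\<lambda>j. fps_nth X j * q_param N \<tau> ^ j) sums (1 / p \<tau>)"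
    using X unfolding cusp_fps_def eventually_Im_at_top by blast
  have "\<forall>\<^sub>F \<tau> in Im_at_top. (\<lambda>j. fps_nth X j * q_param N (of_real k) ^ j * q_param N \<tau> ^ j) sums (1 / p' \<tau>)"
    using eventually_Im_at_top_gt[of "max y 0"]
  proof eventually_elim
    case (elim \<tau>)
    then have "(\<lambda>j. fps_nth X j * q_param N (\<tau> + of_real k) ^ j) sums (1 / p (\<tau> + of_real k))"
      by (intro y) simp
    with shift[of \<tau>] elim show ?case
      by (simp add: q_param_add power_mult_distrib mult_ac in_upper_half_plane_iff)
  qed
  then show ?thesis using X by (simp add: cusp_fps_def)
qed

lemma has_expansion_imp_cusp_fps:
  assumes exp: "has_expansion N c f A B" and fp: "\<And>\<tau>. \<tau> \<in> \<H> \<Longrightarrow> f \<tau> = inv_chart (p \<tau>)"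
  obtains Z where "cusp_fps N p Z" "fps_nth Z 1 = A" "fps_nth Z 2 = B"
proof -
  \<comment> \<open>The polynomials with index below 3 do not occur in the expansion, so the first
    coefficients are entered directly.\<close>
  define Z where "Z = Abs_fps (\<lambda>k. if k = 0 then 0 else if k = 1 then A else if k = 2 then B
                                   else A * poly (c k) (B / A))"
  have A: "A \<noteq> 0" using exp by (simp add: has_expansion_def)
  obtain y0 where y0: "\<And>\<tau>. Im \<tau> > y0 \<Longrightarrow> f \<tau> \<noteq> Infty"
    using exp unfolding has_expansion_def eventually_Im_at_top by blast
  define y where "y = max y0 0"
  have fin: "\<forall>\<tau>. Im \<tau> > y \<longrightarrow> f \<tau> \<noteq> Infty" using y0 by (simp add: y_def)
  have "y \<ge> 0" by (simp add: y_def)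
  have "(\<lambda>k. fps_nth Z k * q_param N \<tau> ^ k) sums (1 / p \<tau>)" if \<tau>: "Im \<tau> > y" for \<tau>
  proof -
    define q where "q = q_param N \<tau>"
    obtain s where s: "(\<lambda>k. poly (c (k + 3)) (B / A) * q ^ (k + 3)) sums s"
      "f \<tau> = Fin (A * (q + B / A * q ^ 2 + s))"
      using exp \<open>y \<ge> 0\<close> fin \<tau> unfolding has_expansion_def q_def by blast
    have "f \<tau> = inv_chart (p \<tau>)" using \<tau> by (intro fp) (simp add: in_upper_half_plane_iff y_def)
    then have p: "1 / p \<tau> = A * (q + B / A * q ^ 2 + s)"
      using s(2) by (auto simp: inv_chart_def split: if_splits)
    have "(\<lambda>k. fps_nth Z (k + 3) * q ^ (k + 3)) = (\<lambda>k. A * (poly (c (k + 3)) (B / A) * q ^ (k + 3)))"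
      by (simp add: Z_def mult.assoc)
    then have "(\<lambda>k. fps_nth Z (k + 3) * q ^ (k + 3)) sums (A * s)"
      using sums_mult[OF s(1), of A] by simp
    then have "(\<lambda>k. fps_nth Z k * q ^ k) sums (A * s + (\<Sum>k<3. fps_nth Z k * q ^ k))"
      by (rule sums_iff_shift[of "\<lambda>k. fps_nth Z k * q ^ k", THEN iffD1])
    also have "A * s + (\<Sum>k<3. fps_nth Z k * q ^ k) = 1 / p \<tau>"
      unfolding p using A by (simp add: Z_def eval_nat_numeral algebra_simps)
    finally show ?thesis unfolding q_def .
  qed
  then have "cusp_fps N p Z" unfolding cusp_fps_def eventually_Im_at_top
    by (auto simp: Z_def)
  then show thesis by (rule that) (simp_all add: Z_def)
qed

lemma cusp_fps_imp_has_expansion: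
  assumes fp: "\<And>\<tau>. \<tau> \<in> \<H> \<Longrightarrow> f \<tau> = inv_chart (p \<tau>)" and inf: "filterlim p at_infinity Im_at_top"
    and X: "fps_nth X 0 = 0" "fps_nth X 1 \<noteq> 0"
    and coeff: "\<And>m. fps_nth X m = fps_nth X 1 * poly (c m) (fps_nth X 2 / fps_nth X 1)"
    and sums: "\<And>y \<tau>. y \<ge> 0 \<Longrightarrow> (\<And>\<tau>. Im \<tau> > y \<Longrightarrow> p \<tau> \<noteq> 0) \<Longrightarrow> Im \<tau> > y \<Longrightarrow>
       (\<lambda>k. fps_nth X k * q_param N \<tau> ^ k) sums (1 / p \<tau>)"
  shows "has_expansion N c f (fps_nth X 1) (fps_nth X 2)"
  unfolding has_expansion_def
proof (intro conjI allI impI)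
  show "fps_nth X 1 \<noteq> 0" by fact
  show "\<forall>\<^sub>F \<tau> in Im_at_top. f \<tau> \<noteq> Infty"
    using eventually_nonzero_if_at_infinity[OF inf] eventually_Im_at_top_gt[of 0]
    by eventually_elim (simp add: fp in_upper_half_plane_iff inv_chart_def)
next
  fix y \<tau> assume y: "0 \<le> y" "\<forall>\<tau>. Im \<tau> > y \<longrightarrow> f \<tau> \<noteq> Infty" and \<tau>: "Im \<tau> > y"
  define A where "A = fps_nth X 1"
  define B where "B = fps_nth X 2"
  define q where "q = q_param N \<tau>"
  have A: "A \<noteq> 0" using X by (simp add: A_def)
  have p0: "p \<sigma> \<noteq> 0" if "Im \<sigma> > y" for \<sigma>
    using y that fp[of \<sigma>] by (auto simp: in_upper_half_plane_iff inv_chart_def)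
  have "(\<lambda>k. fps_nth X k * q ^ k) sums (1 / p \<tau>)"
    unfolding q_def by (rule sums[OF y(1) p0 \<tau>])
  then have "(\<lambda>k. fps_nth X (k + 3) * q ^ (k + 3)) sums (1 / p \<tau> - (\<Sum>k<3. fps_nth X k * q ^ k))"
    by (rule sums_split_initial_segment)
  moreover have "(\<Sum>k<3. fps_nth X k * q ^ k) = A * q + B * q\<^sup>2"
    using X(1) by (simp add: A_def B_def eval_nat_numeral)
  ultimately have "(\<lambda>k. fps_nth X (k + 3) * q ^ (k + 3) / A) sums ((1 / p \<tau> - (A * q + B * q\<^sup>2)) / A)"
    by (intro sums_divide) simp
  moreover have "fps_nth X (k + 3) * q ^ (k + 3) / A = poly (c (k + 3)) (B / A) * q ^ (k + 3)" for k
    using coeff[of "k + 3"] A unfolding A_def[symmetric] B_def[symmetric] by simp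
  ultimately have s: "(\<lambda>k. poly (c (k + 3)) (B / A) * q ^ (k + 3)) sums ((1 / p \<tau> - (A * q + B * q\<^sup>2)) / A)"
    by simp
  have "f \<tau> = Fin (1 / p \<tau>)"
    using fp[of \<tau>] p0[OF \<tau>] \<tau> y(1) by (simp add: in_upper_half_plane_iff inv_chart_def)
  also have "1 / p \<tau> = A * (q + B / A * q ^ 2 + (1 / p \<tau> - (A * q + B * q\<^sup>2)) / A)"
    using A by (simp add: field_simps)
  finally have "f \<tau> = Fin (A * (q + B / A * q ^ 2 + (1 / p \<tau> - (A * q + B * q\<^sup>2)) / A))" .
  with s show "\<exists>s. (\<lambda>k. poly (c (k + 3)) (fps_nth X 2 / fps_nth X 1) * q_param N \<tau> ^ (k + 3)) sums s \<and>
      f \<tau> = Fin (fps_nth X 1 * (q_param N \<tau> + fps_nth X 2 / fps_nth X 1 * q_param N \<tau> ^ 2 + s))"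
    unfolding A_def B_def q_def by blast
qed

text \<open>The matrix acts by \<tau> \<mapsto> -1 / \<tau> and takes infinity to 0, so this
  describes the value at the cusp 0.\<close>

lemma cusp_value_inversion_iff:
  assumes "\<And>\<tau>. \<tau> \<in> \<H> \<Longrightarrow> f \<tau> = inv_chart (p \<tau>)"
  shows "cusp_value f (mat2 0 (-1) 1 0) x \<longleftrightarrow> ((\<lambda>\<tau>. inv_chart (p (- 1 / \<tau>))) \<longlongrightarrow> x) Im_at_top"
  unfolding cusp_value_def
proof (rule filterlim_cong[OF refl refl])
  show "\<forall>\<^sub>F \<tau> in Im_at_top. f (moebius (mat2 0 (-1) 1 0) \<tau>) = inv_chart (p (- 1 / \<tau>))"
    using eventually_Im_at_top_gt[of 0]
  proof eventually_elim
    case (elim \<tau>)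
    then have "- 1 / \<tau> \<in> \<H>"
      by (intro upper_half_plane_inversion) (simp add: in_upper_half_plane_iff)
    moreover have "moebius (mat2 0 (-1) 1 0) \<tau> = - 1 / \<tau>" by (simp add: moebius_mat2)
    ultimately show ?case using assms by simp
  qed
qed

text \<open>The bare set of punctures leaves an N-th root of unity free: \<tau> \<mapsto> \<tau> + 1
  normalises the group, so f(\<tau> + 1) is again an admissible covering with the same punctures,
  but has A and B replaced by \<zeta> A and \<open>\<zeta>\<^sup>2 * B\<close> for \<zeta> = exp(2
  pi i / N). Equality of A and B is therefore stated for punctures labelled by cusps.\<close>

theorem theorem2:
  fixes N n :: nat
  assumes "(N, n) \<in> {(2, 3), (3, 4), (4, 6), (5, 12)}"
  shows "\<exists>c :: nat \<Rightarrow> complex poly.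
    (\<forall>P f. level_covering N n P f \<longrightarrow> (\<exists>A B. has_expansion N c f A B)) \<and>
    (\<forall>P f g A B A' B'.
       level_covering N n P f \<and> has_expansion N c f A B \<and>
       level_covering N n P g \<and> has_expansion N c g A' B' \<longrightarrow>
         (\<exists>\<zeta>. \<zeta> ^ N = 1 \<and> A' = \<zeta> * A \<and> B' = \<zeta>\<^sup>2 * B) \<and>
         ((\<forall>M\<in>SL2Z. \<forall>p. cusp_value f M p \<longleftrightarrow> cusp_value g M p) \<longrightarrow> A' = A \<and> B' = B))"
proof (cases "\<exists>P h. level_covering N n P h")
  case False
  then show ?thesis by blast
next
  case True
  have N: "N > 0" and n: "n \<ge> 3" using assms by auto
  from True obtain P0 h where h: "level_covering N n P0 h" by blast
  define p0 where "p0 = chart_infty \<circ> h"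
  note cov0 = level_covering_imp_cusp_covering[OF h N n, folded p0_def]
  obtain H where H: "cusp_fps N p0 H" "fps_nth H 1 \<noteq> 0" by (rule cusp_covering_fps[OF cov0(1)])
  \<comment> \<open>The polynomials come from one reference covering h, whose punctures may differ
    from those of f; so c is fixed before P and f.\<close>
  define c where "c = coefficient_poly (fps_const (1 / fps_nth H 1) * H)"
  have 1: "\<exists>A B. has_expansion N c f A B" if f: "level_covering N n P f" for P f
  proof -
    define p where "p = chart_infty \<circ> f"
    note cov = level_covering_imp_cusp_covering[OF f N n, folded p_def]
    obtain X where X: "cusp_fps N p X" "fps_nth X 1 \<noteq> 0"
      "\<And>y \<tau>. y \<ge> 0 \<Longrightarrow> (\<And>\<tau>. Im \<tau> > y \<Longrightarrow> p \<tau> \<noteq> 0) \<Longrightarrow> Im \<tau> > y \<Longrightarrow>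
         (\<lambda>k. fps_nth X k * q_param N \<tau> ^ k) sums (1 / p \<tau>)"
      by (rule cusp_covering_fps[OF cov(1)]) blast
    obtain \<alpha> \<beta> where aff: "\<alpha> \<noteq> 0" "\<And>\<tau>. \<tau> \<in> \<H> \<Longrightarrow> p \<tau> = \<alpha> * p0 \<tau> + \<beta>"
      by (rule cusp_coverings_affine[OF cov0(1) cov(1)]) blast
    have "X * (fps_const \<alpha> + fps_const \<beta> * H) = H"
      by (rule cusp_fps_affine[OF N cusp_covering.at_cusp[OF cov0(1)] cusp_covering.at_cusp[OF cov(1)] H(1) X(1) aff(2)])
    then have coeff: "fps_nth X m = fps_nth X 1 * poly (c m) (fps_nth X 2 / fps_nth X 1)" for m
      unfolding c_def by (rule coefficient_poly_moebius[OF _ _ H(2) aff(1)])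
        (use H(1) in \<open>simp add: cusp_fps_def\<close>)
    have "has_expansion N c f (fps_nth X 1) (fps_nth X 2)"
    proof (rule cusp_fps_imp_has_expansion)
      show "f \<tau> = inv_chart (p \<tau>)" if "\<tau> \<in> \<H>" for \<tau> using that by (rule cov(2))
      show "fps_nth X 0 = 0" using X(1) by (simp add: cusp_fps_def)
    qed (rule cusp_covering.at_cusp[OF cov(1)] X coeff; assumption)+
    then show ?thesis by blast
  qed
  have 2: "(\<exists>\<zeta>. \<zeta> ^ N = 1 \<and> A' = \<zeta> * A \<and> B' = \<zeta>\<^sup>2 * B) \<and>
      ((\<forall>M\<in>SL2Z. \<forall>p. cusp_value f M p \<longleftrightarrow> cusp_value g M p) \<longrightarrow> A' = A \<and> B' = B)"
    if f: "level_covering N n P f" and expf: "has_expansion N c f A B"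
      and g: "level_covering N n P g" and expg: "has_expansion N c g A' B'" for P f g A B A' B'
  proof -
    define p where "p = chart_infty \<circ> f"
    define p' where "p' = chart_infty \<circ> g"
    note covf = level_covering_imp_cusp_covering[OF f N n, folded p_def]
    note covg = level_covering_imp_cusp_covering[OF g N n, folded p'_def]
    obtain X where X: "cusp_fps N p X" "fps_nth X 1 = A" "fps_nth X 2 = B"
      by (rule has_expansion_imp_cusp_fps[OF expf covf(2)])
    obtain X' where X': "cusp_fps N p' X'" "fps_nth X' 1 = A'" "fps_nth X' 2 = B'"
      by (rule has_expansion_imp_cusp_fps[OF expg covg(2)])
    obtain t where t: "\<And>\<tau>. \<tau> \<in> \<H> \<Longrightarrow> p' \<tau> = p (\<tau> + of_real t)"
      by (rule cusp_coverings_shift[OF covf(1) covg(1)]) blast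
    have "t \<in> \<int>" by (rule shift_integral[OF covf(1) covg(1) t])
    then obtain k where k: "t = of_int k" by (rule Ints_cases)
    \<comment> \<open>As t is the integer k, this is exp(2 pi i k / N), an N-th root of
      unity.\<close>
    define \<zeta> where "\<zeta> = q_param N (of_real t)"
    have "X' = Abs_fps (\<lambda>j. fps_nth X j * \<zeta> ^ j)"
      unfolding \<zeta>_def by (rule cusp_fps_unique[OF N X'(1) cusp_fps_shift[OF X(1) t]])
    then have AB: "A' = \<zeta> * A" "B' = \<zeta>\<^sup>2 * B" using X(2,3) X'(2,3) by auto
    have "\<zeta> ^ N = exp (of_int (2 * k) * complex_of_real pi * \<i>)"
      using N k by (simp add: \<zeta>_def q_param_def field_simps flip: exp_of_nat_mult)
    also have "\<dots> = 1" by (simp add: exp_eq_1)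
    finally have "\<zeta> ^ N = 1" .
    moreover have "\<zeta> = 1" if same: "\<forall>M\<in>SL2Z. \<forall>x. cusp_value f M x \<longleftrightarrow> cusp_value g M x"
    proof -
      let ?u = "\<lambda>\<tau>. p (- 1 / \<tau>)" and ?v = "\<lambda>\<tau>. p' (- 1 / \<tau>)"
      \<comment> \<open>Comparison at the cusp 0: a common value there forces N to divide k, hence
        \<zeta> = 1.\<close>
      have "mat2 0 (-1) 1 0 \<in> SL2Z" by (simp add: mat2_in_SL2Z_iff)
      with same have iff: "((\<lambda>\<tau>. inv_chart (?u \<tau>)) \<longlongrightarrow> x) Im_at_top \<longleftrightarrow> ((\<lambda>\<tau>. inv_chart (?v \<tau>)) \<longlongrightarrow> x) Im_at_top" for x
        using cusp_value_inversion_iff[of f p x] cusp_value_inversion_iff[of g p' x] covf(2) covg(2) by blast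
      have lim: "(?v \<longlongrightarrow> l) Im_at_top" if "(?u \<longlongrightarrow> l) Im_at_top" for l
      proof -
        have "((\<lambda>\<tau>. inv_chart (?v \<tau>)) \<longlongrightarrow> inv_chart l) Im_at_top"
          using iff tendsto_inv_chart[OF that] by blast
        from tendsto_chart_infty[OF this inv_chart_neq_0] show ?thesis by simp
      qed
      have inf: "filterlim ?v at_infinity Im_at_top" if "filterlim ?u at_infinity Im_at_top"
      proof -
        have "((\<lambda>\<tau>. inv_chart (?v \<tau>)) \<longlongrightarrow> Fin 0) Im_at_top"
          using iff tendsto_inv_chart_at_infinity[OF that] by blast
        from filterlim_chart_infty_at_infinity[OF this] show ?thesis by simp
      qed
      obtain \<tau> \<tau>' where \<tau>: "Im \<tau> > 1" "Im \<tau>' > 1" "?u \<tau> = ?v \<tau>'"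
        by (rule common_cusp_value_at_0[OF covf(1) covg(1) lim inf])
      have "- 1 / \<tau>' \<in> \<H>"
        using \<tau>(2) by (intro upper_half_plane_inversion) (simp add: in_upper_half_plane_iff)
      then have "?u \<tau> = p (- 1 / \<tau>' + of_int k)" using \<tau>(3) t[of "- 1 / \<tau>'"] k by simp
      then have "int N dvd k" by (rule cusp_covering.horoball_at_0_fibre(1)[OF covf(1) \<tau>(1,2)])
      then obtain j where "k = int N * j" by auto
      then have "\<zeta> = exp (of_int (2 * j) * complex_of_real pi * \<i>)"
        using N k by (simp add: \<zeta>_def q_param_def field_simps)
      also have "\<dots> = 1" by (simp add: exp_eq_1)
      finally show ?thesis .
    qed
    ultimately show ?thesis using AB by (intro conjI impI exI[of _ \<zeta>]) simp_all
  qed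
  show ?thesis by (intro exI[of _ c] conjI allI impI; (elim conjE)?) (use 1 2 in blast)+
qed

end
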